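(* Let $P$ be an ideal hexagon in the hyperbolic plane $\mathbb{H}^2$. The following are equivalent: (1) The three geodesics connecting opposite vertices of $P$ meet at a common point (a triple point). (2) $P$ has point reflection symmetry. (3) The alternating perimeter of $P$ is $0$.
   Context: $\mathbb{H}^2$ is the Poincaré disk model of the hyperbolic plane: its points are those of the open unit disk in $\mathbb{C}$; its geodesics are the intersections with the open unit disk of circles meeting the unit circle at right angles (including diameters as degenerate circles). The ideal boundary $\partial\mathbb{H}^2$ is the unit circle, and its points are called ideal points. Hyperbolic distance: for $b\neq c\in\mathbb{H}^2$, if the geodesic through $b,c$ has ideal endpoints $a,d$ labeled so that $a,b,c,d$ occur in order, then $\mathrm{dist}(b,c)=\log\frac{(a-c)(b-d)}{(a-b)(c-d)}$; and $\mathrm{dist}(b,b)=0$. A hyperbolic isometry is a linear fractional transformation $T(z)=\frac{az+b}{cz+d}$ with $a,b,c,d\in\mathbb{C}$, $ad-bc\neq 0$, such that both $T$ and $T^{-1}$ map $\mathbb{H}^2$ to itself (such a map also acts on $\partial\mathbb{H}^2$). A horodisk is a closed Euclidean disk of positive radius contained in $\mathbb{H}^2$ except for a single ideal point; it is said to be centered (or placed) at that ideal point. An ideal hexagon $P$ is the closed loop with six distinct ideal vertices $v_1,\dots,v_6$, listed in cyclic order around the unit circle, obtained by joining consecutive vertices by geodesics. The $k$th side is the geodesic joining $v_k$ to $v_{k+1}$ (indices mod $6$). The pairs of opposite vertices are $(v_1,v_4)$, $(v_2,v_5)$, $(v_3,v_6)$. A hexagon $P$ has point reflection symmetry if there is a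 nontrivial hyperbolic isometry $T$, having a single fixed point in $\mathbb{H}^2$, such that $T(P)=P$ and $T^2$ is the identity. Alternating perimeter: place horodisks $H_1,\dots,H_6$, with $H_k$ centered at $v_k$, such that consecutive ones (cyclically) do not overlap (tangency is allowed). Let $S_k'$ be the finite hyperbolic length of the portion of the $k$th side lying outside the two horodisks centered at its endpoints. The alternating perimeter of $P$ is $(S_1'+S_3'+S_5')-(S_2'+S_4'+S_6')$. This value does not depend on the choice of horodisks. *)

theory Defs
  imports "HOL-Analysis.Analysis"
begin

section \<open>The Poincare disk\<close>

abbreviation hyp_plane :: "complex set" where
  "hyp_plane \<equiv> ball 0 1"

abbreviation ideal_boundary :: "complex set" where
  "ideal_boundary \<equiv> sphere 0 1"

text \<open>
  Circles meeting the unit circle at right angles: at every common point the two radii are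
  orthogonal. The degenerate ones are the lines through the origin.
\<close>

definition orthogonal_circle :: "complex set \<Rightarrow> bool" where
  "orthogonal_circle C \<longleftrightarrow>
     (\<exists>c r. r > 0 \<and> C = sphere c r \<and> C \<inter> ideal_boundary \<noteq> {} \<and>
        (\<forall>z \<in> C \<inter> ideal_boundary. orthogonal z (z - c))) \<or>
     (\<exists>w. w \<noteq> 0 \<and> C = range (\<lambda>t::real. t *\<^sub>R w))"

definition geodesic_joining :: "complex \<Rightarrow> complex \<Rightarrow> complex set" where
  "geodesic_joining u v =
     (THE g. \<exists>C. orthogonal_circle C \<and> u \<in> C \<and> v \<in> C \<and> g = C \<inter> hyp_plane)"

text \<open>
  A parametrization of a geodesic together with its two ideal endpoints, which are the values at
  \<open>0\<close> and \<open>1\<close>. It serves to say that points occur in order along a geodesic.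
\<close>

definition geodesic_param :: "(real \<Rightarrow> complex) \<Rightarrow> bool" where
  "geodesic_param \<gamma> \<longleftrightarrow>
     arc \<gamma> \<and> pathstart \<gamma> \<in> ideal_boundary \<and> pathfinish \<gamma> \<in> ideal_boundary \<and>
     (\<exists>C. orthogonal_circle C \<and> path_image \<gamma> = C \<inter> cball 0 1)"

text \<open>
  For \<open>b \<noteq> c\<close> the four points \<open>\<gamma> 0, b = \<gamma> s, c = \<gamma> t, \<gamma> 1\<close> occur in this order. Their cross ratio
  is a real number greater than \<open>1\<close>, so its principal complex logarithm is real.
\<close>

definition hyp_dist :: "complex \<Rightarrow> complex \<Rightarrow> real" where
  "hyp_dist b c =
     (if b = c then 0
      else (THE x. \<exists>\<gamma> s t. geodesic_param \<gamma> \<and> 0 < s \<and> s < t \<and> t < 1 \<and> \<gamma> s = b \<and> \<gamma> t = c \<and>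
              complex_of_real x =
                Ln (((\<gamma> 0 - c) * (b - \<gamma> 1)) / ((\<gamma> 0 - b) * (c - \<gamma> 1)))))"

definition geodesic_segment :: "complex set \<Rightarrow> complex \<Rightarrow> complex \<Rightarrow> bool" where
  "geodesic_segment A b c \<longleftrightarrow>
     (\<exists>\<gamma> s t. geodesic_param \<gamma> \<and> 0 < s \<and> s \<le> t \<and> t < 1 \<and>
        b = \<gamma> s \<and> c = \<gamma> t \<and> A = \<gamma> ` {s..t})"

definition segment_length :: "complex set \<Rightarrow> real" where
  "segment_length A = (THE L. \<exists>b c. geodesic_segment A b c \<and> L = hyp_dist b c)"


section \<open>Isometries\<close>

definition lin_frac :: "complex \<Rightarrow> complex \<Rightarrow> complex \<Rightarrow> complex \<Rightarrow> complex \<Rightarrow> complex" where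
  "lin_frac a b c d z = (a * z + b) / (c * z + d)"

text \<open>
  Since \<open>x / 0 = 0\<close>, it has to be said explicitly that no point of the disk is sent to infinity.
\<close>

definition lin_frac_preserves_plane :: "complex \<Rightarrow> complex \<Rightarrow> complex \<Rightarrow> complex \<Rightarrow> bool" where
  "lin_frac_preserves_plane a b c d \<longleftrightarrow>
     (\<forall>z \<in> hyp_plane. c * z + d \<noteq> 0 \<and> lin_frac a b c d z \<in> hyp_plane)"

text \<open>
  The inverse of \<open>lin_frac a b c d\<close> is \<open>lin_frac d (- b) (- c) a\<close>. The values of \<open>T\<close> are
  meaningful on the closed unit disk, where \<open>T\<close> has no pole.
\<close>

definition hyp_isometry :: "(complex \<Rightarrow> complex) \<Rightarrow> bool" where
  "hyp_isometry T \<longleftrightarrow>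
     (\<exists>a b c d. a * d - b * c \<noteq> 0 \<and> T = lin_frac a b c d \<and>
        lin_frac_preserves_plane a b c d \<and> lin_frac_preserves_plane d (- b) (- c) a)"


section \<open>Ideal hexagons\<close>

text \<open>
  The vertices are \<open>v 1, \<dots>, v 6\<close>; other values of \<open>v\<close> are irrelevant. They are listed in cyclic
  order, counterclockwise (\<open>\<sigma> = 1\<close>) or clockwise (\<open>\<sigma> = - 1\<close>).
\<close>

definition ideal_hexagon :: "(nat \<Rightarrow> complex) \<Rightarrow> bool" where
  "ideal_hexagon v \<longleftrightarrow>
     (\<exists>(\<theta> :: nat \<Rightarrow> real) \<sigma>. \<sigma> \<in> {1, - 1} \<and> strict_mono_on {1..6} \<theta> \<and> \<theta> 6 < \<theta> 1 + 2 * pi \<and>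
        (\<forall>k \<in> {1..6}. v k = cis (\<sigma> * \<theta> k)))"

definition next_index :: "nat \<Rightarrow> nat" where
  "next_index k = (if k = 6 then 1 else k + 1)"

definition side :: "(nat \<Rightarrow> complex) \<Rightarrow> nat \<Rightarrow> complex set" where
  "side v k = geodesic_joining (v k) (v (next_index k))"

definition hexagon_loop :: "(nat \<Rightarrow> complex) \<Rightarrow> complex set" where
  "hexagon_loop v = (\<Union>k \<in> {1..6}. side v k) \<union> v ` {1..6}"

definition opposite_geodesics_concurrent :: "(nat \<Rightarrow> complex) \<Rightarrow> bool" where
  "opposite_geodesics_concurrent v \<longleftrightarrow>
     (\<exists>p. p \<in> geodesic_joining (v 1) (v 4) \<and> p \<in> geodesic_joining (v 2) (v 5) \<and>
          p \<in> geodesic_joining (v 3) (v 6))"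

definition point_reflection_symmetry :: "complex set \<Rightarrow> bool" where
  "point_reflection_symmetry P \<longleftrightarrow>
     (\<exists>T. hyp_isometry T \<and> (\<exists>z \<in> hyp_plane. T z \<noteq> z) \<and>
        (\<exists>!z. z \<in> hyp_plane \<and> T z = z) \<and> T ` P = P \<and> (\<forall>z \<in> hyp_plane. T (T z) = z))"


section \<open>The alternating perimeter\<close>

definition horodisk_at :: "complex \<Rightarrow> complex set \<Rightarrow> bool" where
  "horodisk_at p H \<longleftrightarrow>
     p \<in> ideal_boundary \<and> (\<exists>c r. r > 0 \<and> H = cball c r) \<and> H - hyp_plane = {p}"

text \<open>Tangent horodisks do not overlap, hence the interiors.\<close>

definition horodisk_choice :: "(nat \<Rightarrow> complex) \<Rightarrow> (nat \<Rightarrow> complex set) \<Rightarrow> bool" where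
  "horodisk_choice v H \<longleftrightarrow>
     (\<forall>k \<in> {1..6}. horodisk_at (v k) (H k)) \<and>
     (\<forall>k \<in> {1..6}. interior (H k) \<inter> interior (H (next_index k)) = {})"

text \<open>
  The boundary points of the horodisks are kept, so that the portion of the side is a compact
  segment, and a single point of length \<open>0\<close> if the two horodisks are tangent.
\<close>

definition outer_side_length :: "(nat \<Rightarrow> complex) \<Rightarrow> (nat \<Rightarrow> complex set) \<Rightarrow> nat \<Rightarrow> real" where
  "outer_side_length v H k =
     segment_length (side v k - (interior (H k) \<union> interior (H (next_index k))))"

text \<open>The value is the same for every choice of horodisks, so the description is definite.\<close>

definition alternating_perimeter :: "(nat \<Rightarrow> complex) \<Rightarrow> real" where
  "alternating_perimeter v =
     (THE x. \<exists>H. horodisk_choice v H \<and>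
        x = (outer_side_length v H 1 + outer_side_length v H 3 + outer_side_length v H 5)
          - (outer_side_length v H 2 + outer_side_length v H 4 + outer_side_length v H 6))"

end

theory Submission
  imports Defs
begin

text \<open>
  Both equivalences compare the symmetric or metric condition with concurrency of the three
  diagonals.

  \<^emph>\<open>Concurrency.\<close> The map \<open>p \<mapsto> 2 p / (1 + |p|\<^sup>2)\<close> carries the Poincare disk to the Klein disk, where
  the geodesic from \<open>u\<close> to \<open>v\<close> is the Euclidean chord, with equation \<open>u + v = k + u v cnj k\<close>
  (\<open>orthocircle_klein_point\<close>). Concurrency of the diagonals is thus concurrency of three
  chords. Chords \<open>ad\<close>, \<open>be\<close>, \<open>cf\<close> satisfy three equations that are linear in \<open>k\<close> and \<open>cnj k\<close>,
  and the determinant of this system factors as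
  \<open>(a - b) (c - d) (e - f) + (b - c) (d - e) (f - a)\<close>. Two diagonals of a hexagon always meet,
  so concurrency means that this determinant vanishes. On the circle, \<open>cis x - cis y\<close> is
  \<open>2 \<i> sin ((x - y) / 2) cis ((x + y) / 2)\<close>, so both summands have the same phase up to sign, the
  cyclic order of the vertices gives them opposite signs, and the condition becomes an equality
  between the products of the lengths of alternate sides, measured as Euclidean chords
  (\<open>concurrent_iff_gaps\<close>).

  \<^emph>\<open>Perimeter.\<close> Along the geodesic from \<open>u\<close> to \<open>v\<close> the function \<open>\<kappa>(z) = (1 - |z|\<^sup>2) / (2 |z - v|\<^sup>2)\<close> is
  a coordinate that runs from \<open>0\<close> to \<open>\<infinity>\<close> (half the Poisson kernel at \<open>v\<close>). The cross ratio that
  defines the distance of \<open>b\<close> and \<open>c\<close> is \<open>\<kappa>(c) / \<kappa>(b)\<close>, and a horodisk at \<open>v\<close> is a condition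
  \<open>\<kappa> \<ge> const\<close>. Hence the part of a side outside horodisks of Euclidean radii \<open>r\<close> and \<open>s\<close> has length
  \<open>ln |u - v|\<^sup>2 + ln ((1 - r) / (2 r)) + ln ((1 - s) / (2 s))\<close> (\<open>outer_segment_length\<close>). Each
  vertex belongs to one odd and one even side, so the horodisk terms cancel in the alternating
  sum, and what remains is the logarithm of the ratio of the two products above.

  \<^emph>\<open>Symmetry.\<close> For \<open>|k| < 1\<close> the map \<open>z \<mapsto> (k - z) / (1 - cnj k z)\<close> is the point reflection whose
  centre has Klein image \<open>k\<close>. The chord equation says exactly that \<open>v\<close> is the image of \<open>u\<close>. If the diagonals
  pass through one point, this reflection exchanges opposite vertices and so preserves the
  hexagon. Conversely every nontrivial involutive isometry is such a map
  (\<open>involution_is_reflection\<close>). If it preserves the hexagon, it pairs the vertices by chords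
  through \<open>k\<close>. Any two of these chords cross, so each of them leaves two vertices on either side and joins
  opposite vertices.
\<close>

section \<open>The orthogonal circle through two ideal points\<close>

text \<open>
  For \<open>u \<noteq> - v\<close> this is the circle with centre \<open>2 u v / (u + v)\<close>, the meeting point of the
  tangents to the unit circle at \<open>u\<close> and \<open>v\<close>. Clearing the denominator makes the same equation
  describe the diameter when \<open>u = - v\<close>.
\<close>

definition orthocircle :: "complex \<Rightarrow> complex \<Rightarrow> complex set" where
  "orthocircle u v = {z. (u + v) * (1 + z * cnj z) = 2 * z + 2 * u * v * cnj z}"

lemma unit_cnj: "norm (u::complex) = 1 \<Longrightarrow> u * cnj u = 1"
  by (simp add: complex_norm_square[symmetric])

text \<open>
  Orthogonality says that \<open>c\<close> lies on the tangent at \<open>u\<close>, that is \<open>Re (c cnj u) = 1\<close>. Multiplying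
  by \<open>2 u\<close> removes the real part. The tangents at two points can then be intersected by linear algebra.
\<close>

lemma unit_orthogonal: 
  assumes "norm (u::complex) = 1" "orthogonal u (u - c)"
  shows "c + u * u * cnj c = 2 * u"
proof -
  have 1: "Re u * Re u + Im u * Im u = 1" using assms(1)
    by (metis cmod_power2 one_power2 power2_eq_square)
  have 2: "Re u * Re c + Im u * Im c = 1"
    using assms(2) 1 by (simp add: orthogonal_def inner_complex_def algebra_simps)
  have "cnj u * c + u * cnj c = 2"
    using 2 by (simp add: complex_eq_iff algebra_simps)
  then have "u * (cnj u * c + u * cnj c) = 2 * u" by simp
  then show ?thesis using unit_cnj[OF assms(1)] by algebra
qed

lemma orthocircle_self: assumes "norm u = 1" "norm v = 1" shows "u \<in> orthocircle u v" "v \<in> orthocircle u v"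
  using unit_cnj[OF assms(1)] unit_cnj[OF assms(2)] unfolding orthocircle_def by (simp_all; algebra)+

lemma sphere_eq:
  assumes "norm u = 1" "(u + v) * cnj c = 2" "(u + v) * c = 2 * u * v" "norm (u - c) = r"
  shows "sphere c r = orthocircle u v"
proof -
  have s0: "u + v \<noteq> 0" using assms(2) by auto
  have uc: "u * cnj u = 1" using unit_cnj[OF assms(1)] .
  have "z \<in> sphere c r \<longleftrightarrow> z \<in> orthocircle u v" for z
  proof -
    have "z \<in> sphere c r \<longleftrightarrow> norm (z - c) ^2 = norm (u - c) ^ 2"
      using assms(4) by (auto simp: dist_norm norm_minus_commute)
    also have "\<dots> \<longleftrightarrow> (z - c) * cnj (z - c) = (u - c) * cnj (u - c)"
      by (metis complex_norm_square of_real_eq_iff)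
    also have "\<dots> \<longleftrightarrow> (u + v) * ((z - c) * cnj (z - c)) = (u + v) * ((u - c) * cnj (u - c))"
      using s0 by simp
    also have "\<dots> \<longleftrightarrow> z \<in> orthocircle u v"
    proof -
      have "(u + v) * ((z - c) * cnj (z - c)) - (u + v) * ((u - c) * cnj (u - c))
         = (u + v) * (1 + z * cnj z) - (2 * z + 2 * u * v * cnj z)"
      proof -
        have "(u + v) * ((z - c) * cnj (z - c)) - (u + v) * ((u - c) * cnj (u - c))
          = (u + v) * (z * cnj z - u * cnj u) + (u - z) * ((u + v) * cnj c) + (cnj u - cnj z) * ((u + v) * c)"
          by (simp add: algebra_simps)
        also have "\<dots> = (u + v) * (z * cnj z - 1) + (u - z) * 2 + (cnj u - cnj z) * (2 * u * v)"
          by (simp only: assms(2,3) uc)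
        also have "\<dots> = (u + v) * (z * cnj z - 1) + (u - z) * 2 + (u * cnj u) * (2 * v) - cnj z * (2 * u * v)"
          by (simp add: algebra_simps)
        also have "\<dots> = (u + v) * (1 + z * cnj z) - (2 * z + 2 * u * v * cnj z)"
          unfolding uc by (simp add: algebra_simps)
        finally show ?thesis .
      qed
      then show ?thesis unfolding orthocircle_def by (smt (verit) eq_iff_diff_eq_0 mem_Collect_eq)
    qed
    finally show ?thesis .
  qed
  then show ?thesis by blast
qed

lemma line_eq:
  assumes "norm u = 1" 
  shows "range (\<lambda>t::real. t *\<^sub>R u) = orthocircle u (-u)"
proof -
  have uc: "u * cnj u = 1" using unit_cnj[OF assms(1)] .
  have "\<exists>t::real. z = t *\<^sub>R u" if "z \<in> orthocircle u (-u)" for z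
  proof -
    have "z = u * u * cnj z" using that unfolding orthocircle_def by (simp add: mult.assoc)
    then have "cnj (z * cnj u) = z * cnj u" using uc by (simp; algebra)
    then have "z * cnj u \<in> \<real>" by (simp add: Reals_cnj_iff)
    then obtain t where "z * cnj u = of_real t" by (auto elim: Reals_cases)
    then have "z = of_real t * u" using uc by (metis mult.assoc mult.commute mult_1)
    then show ?thesis by (auto simp: scaleR_conv_of_real)
  qed
  moreover have "t *\<^sub>R u \<in> orthocircle u (-u)" for t :: real
    using uc unfolding orthocircle_def scaleR_conv_of_real by (simp; algebra)
  ultimately show ?thesis by auto
qed

lemma orthogonal_circle_eq:
  assumes "norm u = 1" "norm v = 1" "u \<noteq> v" "orthogonal_circle C" "u \<in> C" "v \<in> C"
  shows "C = orthocircle u v"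
  using assms(4) unfolding orthogonal_circle_def
proof (elim disjE exE conjE)
  fix c r assume H: "C = sphere c r" "\<forall>z\<in>C \<inter> ideal_boundary. orthogonal z (z - c)"
  have a: "c + u * u * cnj c = 2 * u" "c + v * v * cnj c = 2 * v"
    using H(2) assms by (auto intro!: unit_orthogonal)
  have "(u - v) * ((u + v) * cnj c) = (u - v) * 2" using a by algebra
  then have b: "(u + v) * cnj c = 2" using assms(3) by (metis mult_left_cancel right_minus_eq)
  have "(u + v) * c = 2 * u * v" using a b by algebra
  moreover have "norm (u - c) = r" using H(1) assms(5) by (simp add: dist_norm norm_minus_commute)
  ultimately show ?thesis using sphere_eq[OF assms(1) b] H(1) by blast
next
  fix w :: complex assume w: "w \<noteq> 0" "C = range (\<lambda>t::real. t *\<^sub>R w)"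
  then obtain s t :: real where st: "u = s *\<^sub>R w" "v = t *\<^sub>R w" using assms(5,6) by auto
  have s0: "s \<noteq> 0" using st assms(1) by auto
  \<comment> \<open>A line through the origin meets the unit circle in antipodal points.\<close>
  have "\<bar>s\<bar> * norm w = \<bar>t\<bar> * norm w" using st assms(1,2) by simp
  then have "t = -s" using w(1) st assms(3) by (auto simp: abs_if split: if_splits)
  then have v: "v = -u" using st by simp
  have "range (\<lambda>t::real. t *\<^sub>R w) = range (\<lambda>t::real. t *\<^sub>R u)"
  proof -
    have "x *\<^sub>R w = (x/s) *\<^sub>R u" "x *\<^sub>R u = (x * s) *\<^sub>R w" for x using st s0 by auto
    then show ?thesis by (metis (no_types, lifting) image_cong image_subset_iff rangeI subset_antisym)
  qed
  then show ?thesis using line_eq[OF assms(1)] v w(2) by simp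
qed

lemma orthogonal_circle_orthocircle:
  assumes "norm u = 1" "norm v = 1" "u \<noteq> v"
  shows "orthogonal_circle (orthocircle u v)"
proof (cases "v = -u")
  case True
  have "u \<noteq> 0" using assms(1) by auto
  then show ?thesis using line_eq[OF assms(1)] True unfolding orthogonal_circle_def by metis
next
  case False
  then have s0: "u + v \<noteq> 0" by (metis add_eq_0_iff)
  have uc: "u * cnj u = 1" "v * cnj v = 1" using unit_cnj assms by auto
  have u0: "u \<noteq> 0" "v \<noteq> 0" using assms by auto
  define c where "c = 2 * u * v / (u + v)"
  have 1: "(u + v) * c = 2 * u * v" using s0 by (simp add: c_def)
  have 3: "(cnj u + cnj v) * cnj c = 2 * cnj u * cnj v" using arg_cong[OF 1, of cnj] by simp
  have 2: "(u + v) * cnj c = 2"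
  proof -
    have "(u * v) * ((cnj u + cnj v) * cnj c) = (u * v) * (2 * cnj u * cnj v)" using 3 by simp
    then show ?thesis using uc by algebra
  qed
  have eq: "sphere c (norm (u - c)) = orthocircle u v" using sphere_eq[OF assms(1) 2 1] by simp
  have ne: "u \<noteq> c"
  proof
    assume "u = c"
    then have "(u + v) * u = 2 * u * v" using 1 by metis
    then have "u * (u - v) = 0" by algebra
    then show False using u0 assms by simp
  qed
  have "orthogonal z (z - c)" if z: "z \<in> orthocircle u v" "norm z = 1" for z
  proof -
    have zc: "z * cnj z = 1" using unit_cnj z by auto
    have "(u + v) * (z * cnj c + cnj z * c) = (u + v) * 2"
      using z(1) zc 1 2 unfolding orthocircle_def by (simp; algebra)
    then have "z * cnj c + cnj z * c = 2" using s0 by (metis mult_left_cancel)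
    then have "2 * (Re z * Re c + Im z * Im c) = 2" by (simp add: complex_eq_iff algebra_simps)
    then have "Re z * Re c + Im z * Im c = 1" by simp
    moreover have "Re z * Re z + Im z * Im z = 1"
      using z(2) by (metis cmod_power2 one_power2 power2_eq_square)
    ultimately show ?thesis by (simp add: orthogonal_def inner_complex_def algebra_simps)
  qed
  moreover have "u \<in> orthocircle u v \<inter> ideal_boundary" using orthocircle_self assms by simp
  ultimately show ?thesis unfolding orthogonal_circle_def using eq ne
    by (intro disjI1 exI[of _ c] exI[of _ "norm (u - c)"]) auto
qed

text \<open>
  Existence and uniqueness of the orthogonal circle make the description in the definition of
  \<open>geodesic_joining\<close> definite.
\<close>

lemma geodesic_joining_eq:
  assumes "norm u = 1" "norm v = 1" "u \<noteq> v"
  shows "geodesic_joining u v = orthocircle u v \<inter> hyp_plane"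
  unfolding geodesic_joining_def
  using orthogonal_circle_eq[OF assms] orthogonal_circle_orthocircle[OF assms] orthocircle_self[OF assms(1,2)]
  by (intro the_equality) blast+

lemma orthocircle_boundary:
  assumes "norm u = 1" "norm v = 1" "z \<in> orthocircle u v" "norm z = 1"
  shows "z = u \<or> z = v"
proof -
  have "z * cnj z = 1" using unit_cnj assms by auto
  then have "(z - u) * (z - v) = 0" using assms(3) unfolding orthocircle_def by (simp; algebra)
  then show ?thesis by simp
qed

lemma orthocircle_commute: "orthocircle u v = orthocircle v u" unfolding orthocircle_def by (simp add: algebra_simps)

section \<open>A horocyclic coordinate along a geodesic\<close>

text \<open>
  Half the Poisson kernel with pole \<open>v\<close>. Its level sets are the horocycles at \<open>v\<close>.
\<close>

definition horo_coord :: "complex \<Rightarrow> complex \<Rightarrow> real" where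
  "horo_coord v z = (1 - (norm z)\<^sup>2) / (2 * (dist z v)\<^sup>2)"

text \<open>
  The point with coordinate \<open>k\<close>, found by solving \<open>(u - z) / (z - v) = k (1 - u cnj v)\<close> for \<open>z\<close>.
\<close>

definition geodesic_point :: "complex \<Rightarrow> complex \<Rightarrow> real \<Rightarrow> complex" where
  "geodesic_point u v k = (u + of_real k * (v - u)) / (1 + of_real k * (1 - u * cnj v))"

lemma orthocircle_iff:
  "z \<in> orthocircle u v \<longleftrightarrow> 2 * (u - z) * (v * cnj z - 1) = (v - u) * (1 - z * cnj z)"
proof -
  have "2 * (u - z) * (v * cnj z - 1) - (v - u) * (1 - z * cnj z)
     = 2 * z + 2 * u * v * cnj z - (u + v) * (1 + z * cnj z)"
    by (simp add: algebra_simps)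
  then show ?thesis unfolding orthocircle_def by (smt (verit) eq_iff_diff_eq_0 mem_Collect_eq)
qed

lemma of_real_dist_sq: "of_real ((dist z w)\<^sup>2) = (z - w) * (cnj z - cnj w)"
  by (metis complex_cnj_diff complex_norm_square dist_norm)

lemma of_real_norm_sq: "of_real ((norm z)\<^sup>2) = z * cnj z"
  by (metis complex_norm_square)

lemma horo_coord_pos: "norm v = 1 \<Longrightarrow> norm z < 1 \<Longrightarrow> horo_coord v z > 0"
proof -
  assume "norm v = 1" "norm z < 1"
  then have "dist z v > 0" "(norm z)\<^sup>2 < 1" by (auto simp: abs_square_less_1)
  then show ?thesis unfolding horo_coord_def by simp
qed

text \<open>
  On the geodesic, \<open>(u - z) / (z - v)\<close> has the constant direction of \<open>1 - u cnj v\<close>, and the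
  coordinate is the factor. This turns cross ratios along a geodesic into ratios of
  coordinates.
\<close>

lemma geodesic_split:
  assumes "norm u = 1" "norm v = 1" "z \<in> orthocircle u v" "norm z < 1"
  shows "u - z = of_real (horo_coord v z) * (1 - u * cnj v) * (z - v)"
proof -
  define m where "m = (dist z v)\<^sup>2"
  have m0: "m \<noteq> 0" using assms unfolding m_def by auto
  have vc: "v * cnj v = 1" using unit_cnj assms by auto
  have mm: "of_real m = (z - v) * (cnj z - cnj v)" unfolding m_def by (rule of_real_dist_sq)
  have "cnj v * (2 * (u - z) * (v * cnj z - 1)) = cnj v * ((v - u) * (1 - z * cnj z))"
    using assms(3) orthocircle_iff by simp
  moreover have "cnj v * (2 * (u - z) * (v * cnj z - 1)) = 2 * (u - z) * ((v * cnj v) * cnj z - cnj v)"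
    by (simp add: algebra_simps)
  moreover have "cnj v * ((v - u) * (1 - z * cnj z)) = (v * cnj v - u * cnj v) * (1 - z * cnj z)"
    by (simp add: algebra_simps)
  ultimately have 1: "2 * (u - z) * (cnj z - cnj v) = (1 - u * cnj v) * (1 - z * cnj z)" using vc by simp
  have "2 * (u - z) * of_real m = (2 * (u - z) * (cnj z - cnj v)) * (z - v)" 
    unfolding mm by (simp add: algebra_simps)
  also have "\<dots> = (1 - u * cnj v) * of_real (1 - (norm z)\<^sup>2) * (z - v)" unfolding 1 by (simp add: of_real_norm_sq del: of_real_power)
  finally have "2 * (u - z) * of_real m = (1 - u * cnj v) * of_real (1 - (norm z)\<^sup>2) * (z - v)" .
  moreover have "1 - (norm z)\<^sup>2 = 2 * horo_coord v z * m" using m0 by (simp add: horo_coord_def m_def)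
  ultimately have "of_real (2 * m) * (u - z) = of_real (2 * m) * (of_real (horo_coord v z) * (1 - u * cnj v) * (z - v))"
    by (simp only: of_real_mult) (simp add: algebra_simps)
  then show ?thesis using m0 by (metis mult_left_cancel mult_eq_0_iff of_real_eq_0_iff zero_neq_numeral)
qed

lemma unit_dist_sq:
  assumes "norm u = 1" "norm v = 1"
  shows "(dist u v)\<^sup>2 = 2 - 2 * Re (u * cnj v)" "norm (1 - u * cnj v) = dist u v"
proof -
  have uc: "u * cnj u = 1" "v * cnj v = 1" using unit_cnj assms by auto
  have "of_real ((dist u v)\<^sup>2) = u * cnj u + v * cnj v - (u * cnj v + cnj (u * cnj v))"
    unfolding of_real_dist_sq by (simp add: algebra_simps)
  then have "of_real ((dist u v)\<^sup>2) = (of_real (2 - 2 * Re (u * cnj v)) :: complex)"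
    unfolding uc by (subst (asm) complex_add_cnj) simp
  then show "(dist u v)\<^sup>2 = 2 - 2 * Re (u * cnj v)" by (simp only: of_real_eq_iff)
  have "norm (1 - u * cnj v) = norm ((v - u) * cnj v)" using uc by (simp add: algebra_simps)
  also have "\<dots> = dist u v" using assms by (simp add: norm_mult dist_norm norm_minus_commute)
  finally show "norm (1 - u * cnj v) = dist u v" .
qed

text \<open>
  Everything follows from the two norms \<open>|d|\<^sup>2 = 1 + k D + k\<^sup>2 D\<close> and
  \<open>|z d|\<^sup>2 = 1 - k D + k\<^sup>2 D\<close>, where \<open>d\<close> is the denominator and \<open>D = |u - v|\<^sup>2\<close>.
\<close>

lemma geodesic_point_props:
  assumes "norm u = 1" "norm v = 1" "u \<noteq> v" "k > 0"
  shows "geodesic_point u v k \<in> orthocircle u v" "norm (geodesic_point u v k) < 1" "horo_coord v (geodesic_point u v k) = k"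
proof -
  define z where "z = geodesic_point u v k"
  define d where "d = 1 + of_real k * (1 - u * cnj v)"
  define D where "D = (dist u v)\<^sup>2"
  have D0: "D > 0" using assms by (simp add: D_def)
  have uc: "u * cnj u = 1" "v * cnj v = 1" using unit_cnj assms by auto
  have re: "Re (u * cnj v) = 1 - D / 2" using unit_dist_sq(1)[OF assms(1,2)] unfolding D_def by linarith
  have "Re d = 1 + k * (D / 2)" unfolding d_def using re by simp
  then have d0: "d \<noteq> 0" using D0 assms(4) by (metis add_pos_pos half_gt_zero less_irrefl mult_pos_pos zero_complex.simps(1) zero_less_one)
  have zd: "z * d = u + of_real k * (v - u)" using d0 unfolding z_def geodesic_point_def d_def by simp
  have "(z - v) * d = u - v - of_real k * u + of_real k * u * (v * cnj v)" 
    using zd unfolding d_def by (simp add: algebra_simps)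
  then have zv: "(z - v) * d = u - v" unfolding uc by simp
  have "(u - z) * d = u * d - (u + of_real k * (v - u))" using zd by (simp add: algebra_simps)
  also have "\<dots> = of_real k * (2 * u - v - u * u * cnj v)" unfolding d_def by (simp add: algebra_simps)
  also have "\<dots> = of_real k * (u - v - u * u * cnj v + u * (v * cnj v))" unfolding uc by (simp add: algebra_simps)
  also have "\<dots> = of_real k * (1 - u * cnj v) * (u - v)" by (simp add: algebra_simps)
  also have "\<dots> = (of_real k * (1 - u * cnj v) * (z - v)) * d" unfolding zv[symmetric] by simp
  finally have uz: "u - z = of_real k * (1 - u * cnj v) * (z - v)" using d0 by (metis mult_right_cancel)
  have n1: "(norm (1 + of_real k * w))\<^sup>2 = 1 + 2 * k * Re w + k\<^sup>2 * (norm w)\<^sup>2" for w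
    unfolding cmod_power2 by (simp add: power2_eq_square algebra_simps)
  have nd: "(norm d)\<^sup>2 = 1 + k * D + k\<^sup>2 * D"
    unfolding d_def n1 unit_dist_sq(2)[OF assms(1,2)] using re by (simp add: D_def)
  have "norm (u + of_real k * (v - u)) = norm (u * (1 + of_real k * (v * cnj u - u * cnj u)))"
    using uc(1) by (metis (no_types, opaque_lifting) left_diff_distrib mult.commute mult.left_commute mult.right_neutral ring_class.ring_distribs(1))
  also have "\<dots> = norm (1 + of_real k * (v * cnj u - 1))" unfolding uc norm_mult using assms by simp
  finally have "(norm (z * d))\<^sup>2 = 1 + 2 * k * Re (v * cnj u - 1) + k\<^sup>2 * (norm (v * cnj u - 1))\<^sup>2"
    unfolding zd n1[symmetric] by simp
  moreover have "norm (v * cnj u - 1) = dist u v" 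
    using unit_dist_sq(2)[OF assms(2,1)] by (metis dist_commute norm_minus_commute)
  moreover have "Re (v * cnj u) = 1 - D / 2" using re by (simp add: mult.commute)
  ultimately have nz: "(norm z)\<^sup>2 * (norm d)\<^sup>2 = 1 - k * D + k\<^sup>2 * D"
    by (simp add: D_def norm_mult power_mult_distrib)
  have nzv: "(dist z v)\<^sup>2 * (norm d)\<^sup>2 = D"
    using zv by (metis D_def dist_norm norm_mult power_mult_distrib)
  have "(1 - (norm z)\<^sup>2) * (norm d)\<^sup>2 = (norm d)\<^sup>2 - (norm z)\<^sup>2 * (norm d)\<^sup>2"
    by (simp add: left_diff_distrib)
  also have "\<dots> = 2 * k * D" unfolding nz unfolding nd by simp
  finally have "(1 - (norm z)\<^sup>2) * (norm d)\<^sup>2 = 2 * k * (dist z v)\<^sup>2 * (norm d)\<^sup>2"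
    using nzv by simp
  then have key: "1 - (norm z)\<^sup>2 = 2 * k * (dist z v)\<^sup>2" using d0 by simp
  have zv0: "dist z v > 0" using zv assms(3) by auto
  have "(norm z)\<^sup>2 < 1" using key assms(4) zv0 by (smt (verit) mult_pos_pos zero_less_power)
  then show "norm (geodesic_point u v k) < 1" unfolding z_def by (simp add: abs_square_less_1 power_less_one_iff)
  show "horo_coord v (geodesic_point u v k) = k" using key zv0 unfolding z_def[symmetric] horo_coord_def by simp
  have "2 * (u - z) * (v * cnj z - 1) = 2 * (u - z) * (v * cnj z - v * cnj v)" unfolding uc ..
  also have "\<dots> = (v - u * (v * cnj v)) * (of_real (2 * k) * ((z - v) * (cnj z - cnj v)))"
    unfolding uz by (simp add: algebra_simps)
  also have "\<dots> = (v - u) * (1 - z * cnj z)" 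
    using arg_cong[OF key, of complex_of_real] unfolding uc 
    by (simp add: of_real_dist_sq[symmetric] of_real_norm_sq[symmetric] del: of_real_power)
  finally show "geodesic_point u v k \<in> orthocircle u v" unfolding z_def[symmetric] orthocircle_iff .
qed

lemma geodesic_point_coord:
  assumes "norm u = 1" "norm v = 1" "u \<noteq> v" "z \<in> orthocircle u v" "norm z < 1"
  shows "geodesic_point u v (horo_coord v z) = z"
proof -
  define k where "k = horo_coord v z"
  have vc: "v * cnj v = 1" using unit_cnj assms by auto
  have k0: "k > 0" using horo_coord_pos assms by (simp add: k_def)
  have "Re (1 + of_real k * (1 - u * cnj v)) = 1 + k * (1 - Re (u * cnj v))" by simp
  moreover have "k * (1 - Re (u * cnj v)) \<ge> 0" 
    using unit_dist_sq(1)[OF assms(1,2)] k0 zero_le_power2[of "dist u v"] 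
    by (intro mult_nonneg_nonneg) linarith+
  ultimately have d0: "1 + of_real k * (1 - u * cnj v) \<noteq> 0" 
    by (metis add_pos_nonneg less_irrefl zero_complex.simps(1) zero_less_one)
  have "u - z = of_real k * (1 - u * cnj v) * (z - v)" using geodesic_split assms by (simp add: k_def)
  then have "z * (1 + of_real k * (1 - u * cnj v)) = u + of_real k * (v - u * (v * cnj v))"
    by (simp add: algebra_simps)
  then have "z * (1 + of_real k * (1 - u * cnj v)) = u + of_real k * (v - u)" unfolding vc by simp
  then show ?thesis unfolding k_def[symmetric] geodesic_point_def using d0 by (simp add: field_simps)
qed

text \<open>
  Traversing a geodesic backwards inverts the coordinate up to a constant. This handles
  parametrizations in the opposite direction, and horodisks at the initial endpoint.
\<close>

lemma horo_coord_swap: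
  assumes "norm u = 1" "norm v = 1" "u \<noteq> v" "z \<in> orthocircle u v" "norm z < 1"
  shows "horo_coord u z = 1 / (horo_coord v z * (dist u v)\<^sup>2)"
proof -
  define k where "k = horo_coord v z"
  have k0: "k > 0" using horo_coord_pos assms by (simp add: k_def)
  have zu: "dist z u = k * dist u v * dist z v"
    using arg_cong[OF geodesic_split[OF assms(1,2,4,5)], of norm] unit_dist_sq(2)[OF assms(1,2)] k0
    by (simp add: norm_mult k_def dist_norm norm_minus_commute)
  have v0: "dist z v > 0" using assms by auto
  have u0: "dist u v > 0" using assms by auto
  have "1 - (norm z)\<^sup>2 = 2 * k * (dist z v)\<^sup>2" using v0 by (simp add: k_def horo_coord_def)
  then have "horo_coord u z = (2 * k * (dist z v)\<^sup>2) / (2 * (k * dist u v * dist z v)\<^sup>2)" 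
    unfolding horo_coord_def zu by simp
  also have "\<dots> = 1 / (k * (dist u v)\<^sup>2)" using k0 u0 v0 by (simp add: power2_eq_square field_simps)
  finally show ?thesis by (simp add: k_def)
qed

section \<open>Distances and lengths in the horocyclic coordinate\<close>

text \<open>
  The geodesic point with coordinate \<open>t / (1 - t)\<close>, with the fraction cleared so that the formula
  also covers \<open>t = 1\<close>.
\<close>

definition geodesic_path :: "complex \<Rightarrow> complex \<Rightarrow> real \<Rightarrow> complex" where
  "geodesic_path u v t = (u + of_real t * (v - 2 * u)) / (1 - of_real t * (u * cnj v))"

lemma geodesic_path_denominator:
  assumes "norm u = 1" "norm v = 1" "u \<noteq> v" "0 \<le> t" "t \<le> (1::real)"
  shows "1 - of_real t * (u * cnj v) \<noteq> 0"
proof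
  assume eq: "1 - of_real t * (u * cnj v) = 0"
  then have "norm (of_real t * (u * cnj v)) = 1" by simp
  then have "t = 1" using assms by (simp add: norm_mult)
  then have "u * cnj v = 1" using eq by simp
  then have "u * (v * cnj v) = v" by (simp add: algebra_simps)
  then show False using assms unit_cnj by simp
qed

lemma geodesic_path_eq_geodesic_point:
  assumes "0 \<le> t" "t < 1"
  shows "geodesic_path u v t = geodesic_point u v (t / (1 - t))"
proof -
  have t: "of_real (1 - t) \<noteq> (0::complex)" using assms by (simp only: of_real_eq_0_iff)
  have "geodesic_point u v (t / (1 - t)) 
     = (of_real (1 - t) * (u + of_real (t / (1 - t)) * (v - u))) / (of_real (1 - t) * (1 + of_real (t / (1 - t)) * (1 - u * cnj v)))"
    unfolding geodesic_point_def using t by (metis mult_divide_mult_cancel_left)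
  also have "of_real (1 - t) * (u + of_real (t / (1 - t)) * (v - u)) = u + of_real t * (v - 2 * u)"
    using t by (simp add: distrib_left mult.assoc[symmetric] del: of_real_diff) (simp add: algebra_simps)
  also have "of_real (1 - t) * (1 + of_real (t / (1 - t)) * (1 - u * cnj v)) = 1 - of_real t * (u * cnj v)"
    using t by (simp add: distrib_left mult.assoc[symmetric] del: of_real_diff) (simp add: algebra_simps)
  finally show ?thesis by (simp add: geodesic_path_def)
qed

lemma geodesic_path_ends:
  assumes "norm u = 1" "norm v = 1" "u \<noteq> v"
  shows "geodesic_path u v 0 = u" "geodesic_path u v 1 = v"
proof -
  show "geodesic_path u v 0 = u" by (simp add: geodesic_path_def)
  have "v * (1 - u * cnj v) = v - u * (v * cnj v)" by (simp add: algebra_simps)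
  then have "v * (1 - u * cnj v) = v - u" using unit_cnj assms by simp
  then show "geodesic_path u v 1 = v" using geodesic_path_denominator[OF assms, of 1] by (simp add: geodesic_path_def field_simps)
qed

lemma geodesic_path_inside:
  assumes "norm u = 1" "norm v = 1" "u \<noteq> v" "0 < t" "t < 1"
  shows "geodesic_path u v t \<in> orthocircle u v" "norm (geodesic_path u v t) < 1" "horo_coord v (geodesic_path u v t) = t / (1 - t)"
  using geodesic_point_props[OF assms(1-3), of "t / (1 - t)"] geodesic_path_eq_geodesic_point[of t u v] assms by auto

lemma geodesic_path_param:
  assumes "norm u = 1" "norm v = 1" "u \<noteq> v"
  shows "geodesic_param (geodesic_path u v)"
proof -
  have vc: "v * cnj v = 1" "u * cnj u = 1" using unit_cnj assms by auto
  have "continuous_on {0..1} (geodesic_path u v)"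
    unfolding geodesic_path_def using geodesic_path_denominator[OF assms] by (intro continuous_intros) auto
  moreover have "inj_on (geodesic_path u v) {0..1}"
  proof (rule inj_onI)
    fix s t :: real assume st: "s \<in> {0..1}" "t \<in> {0..1}" "geodesic_path u v s = geodesic_path u v t"
    then have "(u + of_real s * (v - 2 * u)) * (1 - of_real t * (u * cnj v)) = (u + of_real t * (v - 2 * u)) * (1 - of_real s * (u * cnj v))"
      using geodesic_path_denominator[OF assms, of s] geodesic_path_denominator[OF assms, of t]
      unfolding geodesic_path_def by (simp add: frac_eq_eq)
    then have "(of_real t - of_real s) * (v - 2 * u + u * u * cnj v) = 0" by (simp add: algebra_simps)
    then have "(of_real t - of_real s) * (v * (v - 2 * u + u * u * cnj v)) = 0" by auto
    moreover have "v * (v - 2 * u + u * u * cnj v) = v * v - 2 * u * v + u * u * (v * cnj v)" by (simp add: algebra_simps)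
    then have "v * (v - 2 * u + u * u * cnj v) = (v - u) * (v - u)" unfolding vc by (simp add: algebra_simps)
    ultimately show "s = t" using assms(3) by auto
  qed
  ultimately have "arc (geodesic_path u v)" by (simp add: arc_def path_def)
  moreover have "path_image (geodesic_path u v) = orthocircle u v \<inter> cball 0 1"
  proof (intro subset_antisym subsetI)
    fix z assume "z \<in> path_image (geodesic_path u v)"
    then obtain t where t: "0 \<le> t" "t \<le> 1" "z = geodesic_path u v t" by (auto simp: path_image_def)
    consider "t = 0" | "t = 1" | "0 < t" "t < 1" using t by linarith
    then show "z \<in> orthocircle u v \<inter> cball 0 1"
      using t geodesic_path_ends[OF assms] orthocircle_self[OF assms(1,2)] geodesic_path_inside[OF assms, of t] assms
      by cases auto
  next
    fix z assume "z \<in> orthocircle u v \<inter> cball 0 1"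
    then have z: "z \<in> orthocircle u v" "norm z \<le> 1" by auto
    show "z \<in> path_image (geodesic_path u v)"
    proof (cases "norm z = 1")
      case True
      then have "z = u \<or> z = v" using orthocircle_boundary assms z by blast
      then show ?thesis using geodesic_path_ends[OF assms] unfolding path_image_def 
        by (metis atLeastAtMost_iff image_eqI order_refl zero_le_one)
    next
      case False
      then have nz: "norm z < 1" using z by simp
      define k where "k = horo_coord v z"
      have k: "k > 0" using horo_coord_pos assms nz k_def by simp
      have "k / (1 + k) / (1 - k / (1 + k)) = k" using k by (simp add: field_simps)
      moreover have "0 \<le> k / (1 + k)" "k / (1 + k) < 1" using k by auto
      ultimately have "geodesic_path u v (k / (1 + k)) = z"
        using geodesic_path_eq_geodesic_point geodesic_point_coord[OF assms z(1) nz] k_def by metis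
      moreover have "k / (1 + k) \<in> {0..1}" using k by auto
      ultimately show ?thesis unfolding path_image_def by blast
    qed
  qed
  ultimately show ?thesis unfolding geodesic_param_def
    using orthogonal_circle_orthocircle[OF assms] geodesic_path_ends[OF assms] assms
    by (auto simp: pathstart_def pathfinish_def)
qed

text \<open>
  The orthogonal circle of any parametrization is the one through its two endpoints, and it meets the unit circle
  only there. The coordinate is continuous and injective along the path and vanishes at the
  start, so it increases by the intermediate value theorem.
\<close>

lemma geodesic_param_props:
  assumes "geodesic_param g"
  shows "norm (g 0) = 1" "norm (g 1) = 1" "g 0 \<noteq> g 1"
    and "\<And>t. 0 < t \<Longrightarrow> t < 1 \<Longrightarrow> g t \<in> orthocircle (g 0) (g 1) \<and> norm (g t) < 1"
    and "\<And>s t. 0 < s \<Longrightarrow> s < t \<Longrightarrow> t < 1 \<Longrightarrow> horo_coord (g 1) (g s) < horo_coord (g 1) (g t)"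
proof -
  obtain C where C: "orthogonal_circle C" "path_image g = C \<inter> cball 0 1" and a: "arc g"
    using assms unfolding geodesic_param_def by blast
  have cont: "continuous_on {0..1} g" and inj: "inj_on g {0..1}" using a by (auto simp: arc_def path_def)
  show 1: "norm (g 0) = 1" "norm (g 1) = 1"
    using assms unfolding geodesic_param_def pathstart_def pathfinish_def by auto
  show 2: "g 0 \<noteq> g 1" using inj by (metis atLeastAtMost_iff inj_on_eq_iff order_refl zero_le_one zero_neq_one)
  have im: "g t \<in> C" "norm (g t) \<le> 1" if "0 \<le> t" "t \<le> 1" for t
    using C(2) that unfolding path_image_def by auto
  have C': "C = orthocircle (g 0) (g 1)" using orthogonal_circle_eq[OF 1 2 C(1)] im by simp
  show 4: "g t \<in> orthocircle (g 0) (g 1) \<and> norm (g t) < 1" if "0 < t" "t < 1" for t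
  proof -
    have "g t \<noteq> g 0" "g t \<noteq> g 1" using inj that by (auto dest: inj_onD)
    then have "norm (g t) \<noteq> 1" using orthocircle_boundary[OF 1] im[of t] that C' by fastforce
    then show ?thesis using im[of t] that C' by fastforce
  qed
  show "horo_coord (g 1) (g s) < horo_coord (g 1) (g t)" if st: "0 < s" "s < t" "t < 1" for s t
  proof (rule ccontr)
    assume n: "\<not> ?thesis"
    \<comment> \<open>If the coordinate at \<open>s\<close> is at least the one at \<open>t\<close>, the latter is also attained before \<open>s\<close>.\<close>
    have "continuous_on {0..s} (\<lambda>x. horo_coord (g 1) (g x))"
    proof -
      have "g x \<noteq> g 1" if "x \<in> {0..s}" for x using inj that st by (auto dest: inj_onD)
      moreover have "continuous_on {0..s} g" using cont continuous_on_subset st by fastforce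
      ultimately show ?thesis unfolding horo_coord_def by (intro continuous_intros) auto
    qed
    moreover have "horo_coord (g 1) (g 0) \<le> horo_coord (g 1) (g t)"
    proof -
      have "horo_coord (g 1) (g t) > 0" using horo_coord_pos 1 4 st by simp
      then show ?thesis using 1 by (simp add: horo_coord_def)
    qed
    ultimately obtain r where r: "0 \<le> r" "r \<le> s" "horo_coord (g 1) (g r) = horo_coord (g 1) (g t)"
      using IVT'[of "\<lambda>x. horo_coord (g 1) (g x)" 0 "horo_coord (g 1) (g t)" s] n st by auto
    have "horo_coord (g 1) (g t) > 0" using horo_coord_pos 1 4 st by simp
    then have "r \<noteq> 0" using r 1 by (auto simp: horo_coord_def)
    then have "g r = g t"
      using geodesic_point_coord[OF 1 2] 4[of r] 4[of t] r st by (metis le_less_trans less_trans order_le_less)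
    then have "r = t" using inj r st by (auto dest: inj_onD)
    then show False using r st by simp
  qed
qed

text \<open>
  Two points give two linear equations for \<open>u + v\<close> and \<open>u v\<close>, with a nonzero determinant. This pair
  of values determines \<open>{u, v}\<close>.
\<close>

lemma orthocircle_determined:
  assumes "b \<noteq> c" "norm b < 1" "norm c < 1"
    "b \<in> orthocircle u v" "c \<in> orthocircle u v" "b \<in> orthocircle u' v'" "c \<in> orthocircle u' v'"
  shows "(u' = u \<and> v' = v) \<or> (u' = v \<and> v' = u)"
proof -
  define S where "S = u' + v' - (u + v)"
  define P where "P = 2 * (u' * v' - u * v)"
  have b: "S * (1 + b * cnj b) = P * cnj b" 
    using assms(4,6) unfolding orthocircle_def S_def P_def by (simp add: left_diff_distrib right_diff_distrib)
  have c: "S * (1 + c * cnj c) = P * cnj c" 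
    using assms(5,7) unfolding orthocircle_def S_def P_def by (simp add: left_diff_distrib right_diff_distrib)
  have "S = 0"
  proof (rule ccontr)
    assume S: "S \<noteq> 0"
    have "(S * (1 + b * cnj b)) * cnj c = (S * (1 + c * cnj c)) * cnj b" unfolding b c by simp
    then have "S * ((1 + b * cnj b) * cnj c - (1 + c * cnj c) * cnj b) = 0" by (simp add: algebra_simps)
    then have "(1 + b * cnj b) * cnj c - (1 + c * cnj c) * cnj b = 0" using S by simp
    then have "(b - c) * (cnj b * cnj c) = cnj (b - c)" by (simp add: algebra_simps)
    then have "norm (b - c) * (norm b * norm c) = norm (b - c)" by (metis complex_mod_cnj norm_mult)
    then have "norm b * norm c = 1" using assms(1) by simp
    moreover have "norm b * norm c < 1 * 1" using assms(2,3) by (intro mult_strict_mono) auto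
    ultimately show False by simp
  qed
  moreover have "P = 0"
  proof -
    have "P * cnj b = 0" "P * cnj c = 0" using b c \<open>S = 0\<close> by simp_all
    then have "P * cnj (b - c) = 0" by (simp only: complex_cnj_diff right_diff_distrib diff_self)
    then show ?thesis using assms(1) by simp
  qed
  ultimately have e: "u' + v' = u + v" "u' * v' = u * v" unfolding S_def P_def by auto
  then have "(u' - u) * (u' - v) = 0" by algebra
  then show ?thesis using e(1) by auto
qed

lemma cross_ratio_coord:
  assumes "norm u = 1" "norm v = 1" "u \<noteq> v" "b \<in> orthocircle u v" "norm b < 1" "c \<in> orthocircle u v" "norm c < 1"
  shows "((u - c) * (b - v)) / ((u - b) * (c - v)) = of_real (horo_coord v c / horo_coord v b)"
proof -
  have ne: "b \<noteq> v" "c \<noteq> v" using assms by auto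
  have "1 - u * cnj v \<noteq> 0" using unit_dist_sq(2)[OF assms(1,2)] assms(3) by auto
  moreover have "horo_coord v b > 0" using horo_coord_pos assms by simp
  ultimately show ?thesis
    unfolding geodesic_split[OF assms(1,2,4,5)] geodesic_split[OF assms(1,2,6,7)] using ne by simp
qed

text \<open>
  A parametrization through \<open>b\<close> and then \<open>c\<close> must start at \<open>u\<close> and end at \<open>v\<close>: the two
  endpoints are determined by \<open>b\<close> and \<open>c\<close>, and the reverse direction would make the coordinate decrease. Hence
  all admissible parametrizations give the same cross ratio.
\<close>

lemma hyp_dist_coord:
  assumes "norm u = 1" "norm v = 1" "u \<noteq> v" "b \<in> orthocircle u v" "norm b < 1" "c \<in> orthocircle u v" "norm c < 1"
    and less: "horo_coord v b < horo_coord v c"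
  shows "hyp_dist b c = ln (horo_coord v c / horo_coord v b)"
proof -
  have ne: "b \<noteq> c" using less by auto
  have pos: "horo_coord v b > 0" "horo_coord v c > 0" using horo_coord_pos assms by auto
  have Ln: "Ln (((u - c) * (b - v)) / ((u - b) * (c - v))) = of_real (ln (horo_coord v c / horo_coord v b))"
    unfolding cross_ratio_coord[OF assms(1-7)] using pos by (intro Ln_of_real) simp
  have "(THE x. \<exists>\<gamma> s t. geodesic_param \<gamma> \<and> 0 < s \<and> s < t \<and> t < 1 \<and> \<gamma> s = b \<and> \<gamma> t = c \<and>
              complex_of_real x = Ln (((\<gamma> 0 - c) * (b - \<gamma> 1)) / ((\<gamma> 0 - b) * (c - \<gamma> 1))))
      = ln (horo_coord v c / horo_coord v b)"
  proof (rule the_equality)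
    define s where "s = horo_coord v b / (1 + horo_coord v b)"
    define t where "t = horo_coord v c / (1 + horo_coord v c)"
    have st: "0 < s" "s < t" "t < 1" unfolding s_def t_def using pos less by (auto simp: field_simps)
    have "s / (1 - s) = horo_coord v b" "t / (1 - t) = horo_coord v c"
      unfolding s_def t_def using pos by (auto simp: field_simps)
    then have "geodesic_path u v s = b" "geodesic_path u v t = c"
      using geodesic_path_eq_geodesic_point[of s u v] geodesic_path_eq_geodesic_point[of t u v] st geodesic_point_coord[OF assms(1-3)] assms(4-7) by auto
    then show "\<exists>\<gamma> s t. geodesic_param \<gamma> \<and> 0 < s \<and> s < t \<and> t < 1 \<and> \<gamma> s = b \<and> \<gamma> t = c \<and>
              complex_of_real (ln (horo_coord v c / horo_coord v b)) = Ln (((\<gamma> 0 - c) * (b - \<gamma> 1)) / ((\<gamma> 0 - b) * (c - \<gamma> 1)))"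
      using geodesic_path_param[OF assms(1-3)] geodesic_path_ends[OF assms(1-3)] st Ln
      by (intro exI[of _ "geodesic_path u v"] exI[of _ s] exI[of _ t]) simp
  next
    fix x assume "\<exists>\<gamma> s t. geodesic_param \<gamma> \<and> 0 < s \<and> s < t \<and> t < 1 \<and> \<gamma> s = b \<and> \<gamma> t = c \<and>
              complex_of_real x = Ln (((\<gamma> 0 - c) * (b - \<gamma> 1)) / ((\<gamma> 0 - b) * (c - \<gamma> 1)))"
    then obtain g s t where g: "geodesic_param g" "0 < s" "s < t" "t < 1" "g s = b" "g t = c"
      and x: "complex_of_real x = Ln (((g 0 - c) * (b - g 1)) / ((g 0 - b) * (c - g 1)))" by blast
    note G = geodesic_param_props[OF g(1)]
    have bc: "b \<in> orthocircle (g 0) (g 1)" "c \<in> orthocircle (g 0) (g 1)" using G(4)[of s] G(4)[of t] g by auto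
    have lt: "horo_coord (g 1) b < horo_coord (g 1) c" using G(5)[of s t] g by simp
    have "\<not> (g 0 = v \<and> g 1 = u)"
    proof
      assume "g 0 = v \<and> g 1 = u"
      then have "horo_coord u b < horo_coord u c" using lt by simp
      then have "1 / (horo_coord v b * (dist u v)\<^sup>2) < 1 / (horo_coord v c * (dist u v)\<^sup>2)"
        using horo_coord_swap[OF assms(1-3)] assms by simp
      then show False using pos less assms(3) by (simp add: field_simps)
    qed
    then have "g 0 = u" "g 1 = v" using orthocircle_determined[OF ne assms(5,7,4,6) bc] by auto
    then have "complex_of_real x = of_real (ln (horo_coord v c / horo_coord v b))" using x Ln by simp
    then show "x = ln (horo_coord v c / horo_coord v b)" by (simp only: of_real_eq_iff)
  qed
  then show ?thesis unfolding hyp_dist_def using ne by simp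
qed

lemma segment_ends:
  assumes "norm u = 1" "norm v = 1" "u \<noteq> v" "0 < k0" "k0 \<le> k1"
    and A: "A = {z \<in> orthocircle u v \<inter> hyp_plane. k0 \<le> horo_coord v z \<and> horo_coord v z \<le> k1}"
    and g: "geodesic_param g" "0 < s" "s \<le> t" "t < 1" "A = g ` {s..t}" "g 0 = u" "g 1 = v"
  shows "horo_coord v (g s) = k0" "horo_coord v (g t) = k1"
proof -
  note G = geodesic_param_props[OF g(1), unfolded g(6,7)]
  have mono: "horo_coord v (g x) \<le> horo_coord v (g y)" if "s \<le> x" "x \<le> y" "y \<le> t" for x y
    using G(5)[of x y] that g by (cases "x = y") auto
  have inA: "geodesic_point u v k0 \<in> A" "geodesic_point u v k1 \<in> A"
    unfolding A using geodesic_point_props[OF assms(1-3)] assms(4,5) by auto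
  then obtain x y where x: "s \<le> x" "x \<le> t" "geodesic_point u v k0 = g x" and y: "s \<le> y" "y \<le> t" "geodesic_point u v k1 = g y"
    using g(5) by auto
  have "g s \<in> A" "g t \<in> A" using g by auto
  then have "k0 \<le> horo_coord v (g s)" "horo_coord v (g t) \<le> k1" using A by auto
  moreover have "horo_coord v (g s) \<le> k0" using mono[of s x] x geodesic_point_props(3)[OF assms(1-4)] by auto
  moreover have "k1 \<le> horo_coord v (g t)" using mono[of y t] y geodesic_point_props(3)[OF assms(1-3), of k1] assms(4,5) by auto
  ultimately show "horo_coord v (g s) = k0" "horo_coord v (g t) = k1" by auto
qed

lemma segment_dist:
  assumes "norm u = 1" "norm v = 1" "u \<noteq> v" "0 < k0" "k0 \<le> k1"
    and A: "A = {z \<in> orthocircle u v \<inter> hyp_plane. k0 \<le> horo_coord v z \<and> horo_coord v z \<le> k1}"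
    and g: "geodesic_param g" "0 < s" "s \<le> t" "t < 1" "A = g ` {s..t}" "g 0 = u" "g 1 = v"
  shows "hyp_dist (g s) (g t) = ln (k1 / k0)"
proof -
  note e = segment_ends[OF assms]
  have m: "g s \<in> orthocircle u v" "norm (g s) < 1" "g t \<in> orthocircle u v" "norm (g t) < 1"
    using geodesic_param_props(4)[OF g(1)] g by auto
  show ?thesis
  proof (cases "k0 = k1")
    case True
    then have "g s = g t" using e geodesic_point_coord[OF assms(1-3)] m by metis
    then show ?thesis using True assms by (simp add: hyp_dist_def)
  next
    case False
    then show ?thesis using hyp_dist_coord[OF assms(1-3) m] e assms(5) by simp
  qed
qed

text \<open>
  The set determines its endpoints up to order. A parametrization from \<open>v\<close> to \<open>u\<close> is covered by
  describing the same set in the coordinate of the reversed geodesic, which has the same ratio of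
  endpoint coordinates.
\<close>

lemma segment_length_coord:
  assumes "norm u = 1" "norm v = 1" "u \<noteq> v" "0 < k0" "k0 \<le> k1"
  shows "segment_length {z \<in> orthocircle u v \<inter> hyp_plane. k0 \<le> horo_coord v z \<and> horo_coord v z \<le> k1} = ln (k1 / k0)"
proof -
  define A where "A = {z \<in> orthocircle u v \<inter> hyp_plane. k0 \<le> horo_coord v z \<and> horo_coord v z \<le> k1}"
  define D where "D = (dist u v)\<^sup>2"
  have D: "D > 0" using assms(3) by (simp add: D_def)
  have k1: "k1 > 0" using assms by simp
  have A': "A = {z \<in> orthocircle v u \<inter> hyp_plane. 1 / (k1 * D) \<le> horo_coord u z \<and> horo_coord u z \<le> 1 / (k0 * D)}"
  proof -
    have "k0 \<le> horo_coord v z \<and> horo_coord v z \<le> k1 \<longleftrightarrow> 1 / (k1 * D) \<le> horo_coord u z \<and> horo_coord u z \<le> 1 / (k0 * D)"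
      if "z \<in> orthocircle u v" "norm z < 1" for z
    proof -
      have "horo_coord v z > 0" using horo_coord_pos assms that by simp
      then show ?thesis unfolding horo_coord_swap[OF assms(1-3) that] D_def[symmetric]
        using D assms(4) k1 by (auto simp: field_simps)
    qed
    then show ?thesis unfolding A_def orthocircle_commute[of v u] by auto
  qed
  have ratio: "(1 / (k0 * D)) / (1 / (k1 * D)) = k1 / k0" using D assms(4) k1 by (simp add: field_simps)
  have "(THE L. \<exists>b c. geodesic_segment A b c \<and> L = hyp_dist b c) = ln (k1 / k0)"
  proof (rule the_equality)
    define s where "s = k0 / (1 + k0)"
    define t where "t = k1 / (1 + k1)"
    have st: "0 < s" "s \<le> t" "t < 1" unfolding s_def t_def using assms(4,5) by (auto simp: field_simps)
    have "s / (1 - s) = k0" "t / (1 - t) = k1" unfolding s_def t_def using assms(4) k1 by (auto simp: field_simps)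
    have img: "A = geodesic_path u v ` {s..t}"
    proof (intro subset_antisym subsetI)
      fix z assume "z \<in> A"
      then have z: "z \<in> orthocircle u v" "norm z < 1" "k0 \<le> horo_coord v z" "horo_coord v z \<le> k1" by (auto simp: A_def)
      define r where "r = horo_coord v z / (1 + horo_coord v z)"
      have r: "s \<le> r" "r \<le> t" "r / (1 - r) = horo_coord v z"
        unfolding r_def s_def t_def using z assms(4) by (auto simp: field_simps)
      then have "geodesic_path u v r = z"
        using geodesic_path_eq_geodesic_point[of r u v] geodesic_point_coord[OF assms(1-3) z(1,2)] st by simp
      then show "z \<in> geodesic_path u v ` {s..t}" using r by auto
    next
      fix z assume "z \<in> geodesic_path u v ` {s..t}"
      then obtain r where r: "s \<le> r" "r \<le> t" "z = geodesic_path u v r" by auto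
      then have "z \<in> orthocircle u v" "norm z < 1" "horo_coord v z = r / (1 - r)"
        using geodesic_path_inside[OF assms(1-3), of r] st by auto
      moreover have "k0 \<le> r / (1 - r)" "r / (1 - r) \<le> k1"
      proof -
        have "1 - r > 0" using r st by simp
        moreover have "k0 * (1 - r) \<le> r" "r \<le> k1 * (1 - r)"
          using r(1,2) k1 assms(4) unfolding s_def t_def by (auto simp: field_simps)
        ultimately show "k0 \<le> r / (1 - r)" "r / (1 - r) \<le> k1"
          by (simp_all add: pos_le_divide_eq pos_divide_le_eq)
      qed
      ultimately show "z \<in> A" by (simp add: A_def)
    qed
    have "geodesic_segment A (geodesic_path u v s) (geodesic_path u v t)"
      unfolding geodesic_segment_def using geodesic_path_param[OF assms(1-3)] st img by blast
    moreover have "hyp_dist (geodesic_path u v s) (geodesic_path u v t) = ln (k1 / k0)"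
      using segment_dist[OF assms A_def geodesic_path_param[OF assms(1-3)] st img geodesic_path_ends[OF assms(1-3)]] .
    ultimately show "\<exists>b c. geodesic_segment A b c \<and> ln (k1 / k0) = hyp_dist b c" by metis
  next
    fix L assume "\<exists>b c. geodesic_segment A b c \<and> L = hyp_dist b c"
    then obtain g s t where g: "geodesic_param g" "0 < s" "s \<le> t" "t < 1" "A = g ` {s..t}" and L: "L = hyp_dist (g s) (g t)"
      unfolding geodesic_segment_def by blast
    note G = geodesic_param_props[OF g(1)]
    have P: "geodesic_point u v k0 \<in> A" "geodesic_point u v k1 \<in> A"
      unfolding A_def using geodesic_point_props[OF assms(1-3)] assms(4,5) by auto
    show "L = ln (k1 / k0)"
    proof (cases "k0 = k1")
      case True
      have single: "z = geodesic_point u v k0" if "z \<in> A" for z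
      proof -
        have "z \<in> orthocircle u v" "norm z < 1" "horo_coord v z = k0" using that True unfolding A_def by auto
        then show ?thesis using geodesic_point_coord[OF assms(1-3)] by metis
      qed
      have "g s \<in> A" "g t \<in> A" using g by auto
      then have "g s = geodesic_point u v k0" "g t = geodesic_point u v k0" using single by blast+
      then show ?thesis using L True assms(4) by (simp add: hyp_dist_def)
    next
      case False
      have ne: "geodesic_point u v k0 \<noteq> geodesic_point u v k1"
        using False geodesic_point_props(3)[OF assms(1-3)] assms(4) k1 by metis
      have sub: "z \<in> orthocircle (g 0) (g 1)" if "z \<in> A" for z
        using that G(4) g by auto
      have "(g 0 = u \<and> g 1 = v) \<or> (g 0 = v \<and> g 1 = u)"
        using orthocircle_determined[OF ne] geodesic_point_props[OF assms(1-3)] assms(4) k1 sub P by blast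
      then show ?thesis
      proof
        assume "g 0 = u \<and> g 1 = v"
        then show ?thesis using segment_dist[OF assms A_def g] L by simp
      next
        assume e: "g 0 = v \<and> g 1 = u"
        have "0 < 1 / (k1 * D)" "1 / (k1 * D) \<le> 1 / (k0 * D)" using D k1 assms(4,5) by (auto simp: field_simps)
        then have "hyp_dist (g s) (g t) = ln ((1 / (k0 * D)) / (1 / (k1 * D)))"
          using segment_dist[OF assms(2,1) _ _ _ A' g] assms(3) e by auto
        then show ?thesis using L ratio by simp
      qed
    qed
  qed
  then show ?thesis unfolding segment_length_def A_def .
qed

section \<open>Horodisks and the alternating perimeter\<close>

lemma dist_sq_scale:
  assumes "norm p = 1"
  shows "(dist z (of_real t * p))\<^sup>2 = (norm z)\<^sup>2 - 2 * t * (Re z * Re p + Im z * Im p) + t\<^sup>2"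
proof -
  have p: "(Re p)\<^sup>2 + (Im p)\<^sup>2 = 1" using assms by (metis cmod_power2 one_power2)
  have "(dist z (of_real t * p))\<^sup>2 = (norm z)\<^sup>2 - 2 * t * (Re z * Re p + Im z * Im p) + t\<^sup>2 * ((Re p)\<^sup>2 + (Im p)\<^sup>2)"
    unfolding dist_norm cmod_power2 by (simp add: power2_eq_square algebra_simps)
  then show ?thesis unfolding p by simp
qed

text \<open>
  The left-hand side is the power of \<open>z\<close> with respect to the horocycle, which belongs to the
  pencil of the point circle at \<open>p\<close> and the unit circle. Inside the disk this makes a horodisk
  a superlevel set of \<open>horo_coord\<close>.
\<close>

lemma horodisk_power:
  assumes "norm (p::complex) = 1"
  shows "(dist z (of_real (1 - r) * p))\<^sup>2 - r\<^sup>2 = (1 - r) * (dist z p)\<^sup>2 - r * (1 - (norm z)\<^sup>2)"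
proof -
  have "(dist z p)\<^sup>2 = (norm z)\<^sup>2 - 2 * (Re z * Re p + Im z * Im p) + 1"
    using dist_sq_scale[OF assms, of z 1] by simp
  then show ?thesis unfolding dist_sq_scale[OF assms] by (simp only:) (simp add: power2_eq_square algebra_simps)
qed

text \<open>
  The point of the closed disk farthest from the origin has norm at least \<open>1\<close>, because \<open>p\<close> does.
  So it is \<open>p\<close> itself, and the centre lies on the radius to \<open>p\<close>.
\<close>

lemma horodisk_at_imp:
  assumes "horodisk_at p H"
  obtains r where "0 < r" "r < 1" "H = cball (of_real (1 - r) * p) r"
proof -
  obtain c r where 1: "p \<in> ideal_boundary" and 2: "r > 0" "H = cball c r" and 3: "H - hyp_plane = {p}"
    using assms unfolding horodisk_at_def by blast
  have np: "norm p = 1" using 1 by simp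
  note cr = np 2 3[unfolded 2(2)]
  have only: "z = p" if "z \<in> cball c r" "norm z \<ge> 1" for z
  proof -
    have "z \<in> cball c r - hyp_plane" using that by simp
    then show ?thesis unfolding cr(4) by simp
  qed
  have "p \<in> cball c r - hyp_plane" unfolding cr(4) by simp
  then have p: "dist c p \<le> r" by simp
  have c0: "c \<noteq> 0"
  proof
    assume "c = 0"
    then have "-p = p" using only[of "-p"] p cr(1) by simp
    then show False using cr(1) by auto
  qed
  define t where "t = 1 + r / norm c"
  define w where "w = of_real t * c"
  have t: "t > 0" unfolding t_def using cr(2) by (simp add: add_pos_nonneg)
  have "w - c = of_real (r / norm c) * c" by (simp add: w_def t_def algebra_simps)
  then have wc: "dist c w = r" using c0 cr(2) by (simp add: dist_norm norm_minus_commute[of c w] norm_mult norm_divide)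
  have "norm w = t * norm c" using t by (simp add: w_def norm_mult)
  also have "\<dots> = norm c + r" using c0 by (simp add: t_def field_simps)
  finally have nw: "norm w = norm c + r" .
  have "norm p \<le> norm c + dist c p" by (metis dist_norm norm_minus_commute norm_triangle_sub)
  then have "norm w \<ge> 1" using nw p cr(1) by simp
  then have wp: "w = p" using only wc by simp
  then have e: "norm c + r = 1" using nw cr(1) by simp
  have "(1 - r) * t = 1" using e c0 unfolding t_def by (simp add: field_simps)
  then have "c = of_real (1 - r) * p" unfolding wp[symmetric] w_def 
    by (simp add: mult.assoc[symmetric] of_real_mult[symmetric] del: of_real_mult of_real_diff)
  moreover have "r < 1" using e c0 by (smt (verit) zero_less_norm_iff)
  ultimately show ?thesis using cr that by blast
qed

lemma horodisk_atI:
  assumes "norm p = 1" "0 < r" "r < 1"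
  shows "horodisk_at p (cball (of_real (1 - r) * p) r)"
proof -
  have "z = p" if z: "dist (of_real (1 - r) * p) z \<le> r" "norm z \<ge> 1" for z
  proof -
    have "(dist z (of_real (1 - r) * p))\<^sup>2 \<le> r\<^sup>2" using z(1) by (metis dist_commute power_mono zero_le_dist)
    then have "(1 - r) * (dist z p)\<^sup>2 \<le> r * (1 - (norm z)\<^sup>2)" using horodisk_power[OF assms(1), of z r] by linarith
    moreover have "r * (1 - (norm z)\<^sup>2) \<le> 0" using z(2) assms by (simp add: mult_nonneg_nonpos)
    ultimately have "(1 - r) * (dist z p)\<^sup>2 \<le> 0" by linarith
    then show ?thesis using assms(3) by (auto simp: mult_le_0_iff)
  qed
  moreover have "dist (of_real (1 - r) * p) p = r"
  proof -
    have "of_real (1 - r) * p - p = - (of_real r * p)" by (simp add: algebra_simps)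
    then show ?thesis using assms by (simp add: dist_norm norm_mult del: of_real_diff)
  qed
  ultimately have "cball (of_real (1 - r) * p) r - hyp_plane = {p}" using assms(1) by (auto simp del: of_real_diff)
  then show ?thesis unfolding horodisk_at_def using assms by auto
qed

lemma horodisk_interior_iff:
  assumes "norm p = 1" "0 < r" "norm z < 1"
  shows "z \<in> interior (cball (of_real (1 - r) * p) r) \<longleftrightarrow> (1 - r) / (2 * r) < horo_coord p z"
proof -
  have d0: "(dist z p)\<^sup>2 > 0" using assms by auto
  have "z \<in> interior (cball (of_real (1 - r) * p) r) \<longleftrightarrow> dist z (of_real (1 - r) * p) < r"
    by (simp add: dist_commute del: of_real_diff)
  also have "\<dots> \<longleftrightarrow> (dist z (of_real (1 - r) * p))\<^sup>2 < r\<^sup>2" using assms(2)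
    by (meson less_imp_le pos2 power2_less_imp_less power_strict_mono zero_le_dist)
  also have "\<dots> \<longleftrightarrow> (1 - r) * (dist z p)\<^sup>2 < r * (1 - (norm z)\<^sup>2)" using horodisk_power[OF assms(1), of z r] by linarith
  also have "\<dots> \<longleftrightarrow> (1 - r) / (2 * r) < horo_coord p z" unfolding horo_coord_def using d0 assms(2)
    by (simp add: divide_less_eq less_divide_eq mult.commute mult.left_commute)
  finally show ?thesis .
qed

definition horo_height :: "real \<Rightarrow> real" where "horo_height r = ln ((1 - r) / (2 * r))"

text \<open>
  The two horodisks cut the coordinate line to an interval \<open>{k0..k1}\<close>. It is nonempty because a
  coordinate between \<open>k1\<close> and \<open>k0\<close> would give a point in both interiors.
\<close>

lemma outer_segment_length:
  assumes uv: "norm u = 1" "norm v = 1" "u \<noteq> v" and r: "0 < r" "r < 1" and s: "0 < s" "s < 1"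
    and disj: "interior (cball (of_real (1 - r) * u) r) \<inter> interior (cball (of_real (1 - s) * v) s) = {}"
  shows "segment_length (geodesic_joining u v - (interior (cball (of_real (1 - r) * u) r) \<union> interior (cball (of_real (1 - s) * v) s)))
    = ln ((dist u v)\<^sup>2) + horo_height r + horo_height s"
proof -
  define D where "D = (dist u v)\<^sup>2"
  define k0 where "k0 = 2 * r / ((1 - r) * D)"
  define k1 where "k1 = (1 - s) / (2 * s)"
  have D: "D > 0" using uv by (simp add: D_def)
  have pos: "k0 > 0" "k1 > 0" using D r s by (auto simp: k0_def k1_def)
  have inu: "z \<in> interior (cball (of_real (1 - r) * u) r) \<longleftrightarrow> horo_coord v z < k0"
    if "z \<in> orthocircle u v" "norm z < 1" for z
  proof -
    have "horo_coord v z > 0" using horo_coord_pos uv that by simp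
    then show ?thesis
      unfolding horodisk_interior_iff[OF uv(1) r(1) that(2)] horo_coord_swap[OF uv that] k0_def D_def[symmetric]
      using D r by (simp add: field_simps)
  qed
  have inv: "z \<in> interior (cball (of_real (1 - s) * v) s) \<longleftrightarrow> k1 < horo_coord v z" if "norm z < 1" for z
    unfolding k1_def by (rule horodisk_interior_iff[OF uv(2) s(1) that])
  have le: "k0 \<le> k1"
  proof (rule ccontr)
    assume "\<not> k0 \<le> k1"
    then obtain k where k: "k1 < k" "k < k0" using dense[of k1 k0] by (auto simp: not_le)
    then have "k > 0" using pos by simp
    note g = geodesic_point_props[OF uv this]
    show False using inu[OF g(1,2)] inv[OF g(2)] g(3) k disj by auto
  qed
  have "z \<notin> interior (cball (of_real (1 - r) * u) r) \<and> z \<notin> interior (cball (of_real (1 - s) * v) s)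
      \<longleftrightarrow> k0 \<le> horo_coord v z \<and> horo_coord v z \<le> k1" if "z \<in> orthocircle u v \<inter> hyp_plane" for z
  proof -
    have z: "z \<in> orthocircle u v" "norm z < 1" using that by simp_all
    show ?thesis unfolding inu[OF z] inv[OF z(2)] not_less ..
  qed
  then have "geodesic_joining u v - (interior (cball (of_real (1 - r) * u) r) \<union> interior (cball (of_real (1 - s) * v) s))
    = {z \<in> orthocircle u v \<inter> hyp_plane. k0 \<le> horo_coord v z \<and> horo_coord v z \<le> k1}"
    unfolding geodesic_joining_eq[OF uv] set_diff_eq Un_iff de_Morgan_disj by (rule Collect_cong[OF conj_cong[OF refl]])
  moreover have "ln (k1 / k0) = ln D + horo_height r + horo_height s"
  proof -
    have "k1 / k0 = D * ((1 - r) / (2 * r)) * ((1 - s) / (2 * s))" using r s D by (simp add: k0_def k1_def mult.commute mult.left_commute)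
    moreover have "(1 - r) / (2 * r) > 0" "(1 - s) / (2 * s) > 0" using r s by simp_all
    moreover have "ln (D * x * y) = ln D + ln x + ln y" if "x > 0" "y > 0" for x y :: real
      using that D by (simp add: ln_mult)
    ultimately show ?thesis unfolding horo_height_def by metis
  qed
  ultimately show ?thesis using segment_length_coord[OF uv pos(1) le] by (simp add: D_def)
qed

lemma next_index_simps:
  "next_index 1 = 2" "next_index 2 = 3" "next_index 3 = 4" "next_index 4 = 5" "next_index 5 = 6" "next_index 6 = 1"
  by (simp_all add: next_index_def)

text \<open>
  The horodisk terms of consecutive sides cancel, so every choice of horodisks gives the same
  value. A choice exists: all radii may be \<open>d / (2 + d)\<close> with \<open>d\<close> the smallest distance between consecutive
  vertices.
\<close>

lemma alternating_perimeter_eq: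
  assumes n: "\<And>k. k \<in> {1..6} \<Longrightarrow> norm (v k) = 1" and inj: "inj_on v {1..6}"
  shows "alternating_perimeter v =
     ln ((dist (v 1) (v 2))\<^sup>2) + ln ((dist (v 3) (v 4))\<^sup>2) + ln ((dist (v 5) (v 6))\<^sup>2)
   - (ln ((dist (v 2) (v 3))\<^sup>2) + ln ((dist (v 4) (v 5))\<^sup>2) + ln ((dist (v 6) (v 1))\<^sup>2))" (is "_ = ?R")
proof -
  have ni: "next_index k \<in> {1..6}" "next_index k \<noteq> k" if "k \<in> {1..6}" for k
    using that by (auto simp: next_index_def)
  have ne: "v k \<noteq> v (next_index k)" if "k \<in> {1..6}" for k
    using inj ni[OF that] that by (metis inj_onD)
  show ?thesis unfolding alternating_perimeter_def
  proof (rule the_equality)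
    fix x assume "\<exists>H. horodisk_choice v H \<and>
        x = (outer_side_length v H 1 + outer_side_length v H 3 + outer_side_length v H 5)
          - (outer_side_length v H 2 + outer_side_length v H 4 + outer_side_length v H 6)"
    then obtain H where H: "horodisk_choice v H" and
      x: "x = (outer_side_length v H 1 + outer_side_length v H 3 + outer_side_length v H 5)
          - (outer_side_length v H 2 + outer_side_length v H 4 + outer_side_length v H 6)" by blast
    have "\<forall>k\<in>{1..6}. \<exists>r. 0 < r \<and> r < 1 \<and> H k = cball (of_real (1 - r) * v k) r"
      using H unfolding horodisk_choice_def by (meson horodisk_at_imp)
    then obtain r where r: "\<And>k. k \<in> {1..6} \<Longrightarrow> 0 < r k \<and> r k < 1 \<and> H k = cball (of_real (1 - r k) * v k) (r k)"
      by metis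
    have len: "outer_side_length v H k = ln ((dist (v k) (v (next_index k)))\<^sup>2) + horo_height (r k) + horo_height (r (next_index k))"
      if k: "k \<in> {1..6}" for k
    proof -
      have "interior (H k) \<inter> interior (H (next_index k)) = {}" using H k unfolding horodisk_choice_def by blast
      then show ?thesis
        using outer_segment_length[OF n[OF k] n[OF ni(1)[OF k]] ne[OF k], of "r k" "r (next_index k)"] r[OF k] r[OF ni(1)[OF k]]
        unfolding outer_side_length_def side_def by metis
    qed
    show "x = ?R" unfolding x using len[of 1] len[of 2] len[of 3] len[of 4] len[of 5] len[of 6]
      unfolding next_index_simps by simp
  next
    define d where "d = Min ((\<lambda>k. dist (v k) (v (next_index k))) ` {1..6})"
    have d: "d > 0" unfolding d_def using ne by (subst Min_gr_iff) auto
    have dk: "d \<le> dist (v k) (v (next_index k))" if "k \<in> {1..6}" for k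
      unfolding d_def using that by (intro Min_le) auto
    \<comment> \<open>For this radius, horodisks at vertices of distance \<open>d\<close> are tangent.\<close>
    define r where "r = d / (2 + d)"
    have r: "0 < r" "r < 1" "2 * r = (1 - r) * d" using d by (auto simp: r_def field_simps)
    define H where "H k = cball (of_real (1 - r) * v k) r" for k
    have H: "horodisk_choice v H" unfolding horodisk_choice_def
    proof (intro conjI ballI)
      fix k assume k: "k \<in> {1..6::nat}"
      show "horodisk_at (v k) (H k)" unfolding H_def using horodisk_atI n k r by blast
      have "dist (of_real (1 - r) * v k) (of_real (1 - r) * v (next_index k)) = (1 - r) * dist (v k) (v (next_index k))"
        using r by (simp add: dist_norm right_diff_distrib[symmetric] norm_mult del: of_real_diff)
      also have "\<dots> \<ge> (1 - r) * d" using r dk[OF k] by (intro mult_left_mono) auto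
      finally show "interior (H k) \<inter> interior (H (next_index k)) = {}"
        unfolding H_def interior_cball using r(3) by (intro disjoint_ballI) simp
    qed
    have len: "outer_side_length v H k = ln ((dist (v k) (v (next_index k)))\<^sup>2) + horo_height r + horo_height r"
      if k: "k \<in> {1..6}" for k
    proof -
      have "interior (H k) \<inter> interior (H (next_index k)) = {}" using H k unfolding horodisk_choice_def by blast
      then show ?thesis
        using outer_segment_length[OF n[OF k] n[OF ni(1)[OF k]] ne[OF k] r(1,2) r(1,2)]
        unfolding outer_side_length_def side_def H_def by blast
    qed
    have "?R = (outer_side_length v H 1 + outer_side_length v H 3 + outer_side_length v H 5)
          - (outer_side_length v H 2 + outer_side_length v H 4 + outer_side_length v H 6)"
      using len[of 1] len[of 2] len[of 3] len[of 4] len[of 5] len[of 6]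
      unfolding next_index_simps by simp
    then show "\<exists>H. horodisk_choice v H \<and> ?R = (outer_side_length v H 1 + outer_side_length v H 3 + outer_side_length v H 5)
          - (outer_side_length v H 2 + outer_side_length v H 4 + outer_side_length v H 6)" using H by blast
  qed
qed

section \<open>Chords of the unit circle and the Klein model\<close>

text \<open>
  The equation of the Euclidean line through two points \<open>u\<close>, \<open>v\<close> of the unit circle.
\<close>

definition on_chord :: "complex \<Rightarrow> complex \<Rightarrow> complex \<Rightarrow> bool" where
  "on_chord u v k \<longleftrightarrow> u + v = k + u * v * cnj k"

text \<open>
  The isomorphism from the Poincare model to the Klein model.
\<close>

definition klein_point :: "complex \<Rightarrow> complex" where
  "klein_point p = 2 * p / of_real (1 + (norm p)\<^sup>2)"

lemma orthocircle_klein_point: "p \<in> orthocircle u v \<longleftrightarrow> on_chord u v (klein_point p)"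
proof -
  define s where "s = complex_of_real (1 + (norm p)\<^sup>2)"
  have s: "s = 1 + p * cnj p" "cnj s = s" unfolding s_def by (simp_all add: of_real_norm_sq[symmetric] del: of_real_power)
  have "1 + (norm p)\<^sup>2 \<noteq> 0" by (metis add_pos_nonneg less_irrefl zero_le_power2 zero_less_one)
  then have s0: "s \<noteq> 0" unfolding s_def of_real_eq_0_iff .
  have k: "s * klein_point p = 2 * p" "s * cnj (klein_point p) = 2 * cnj p"
    unfolding klein_point_def s_def[symmetric] using s0 s(2) by simp_all
  have "on_chord u v (klein_point p) \<longleftrightarrow> s * (u + v) = s * (klein_point p + u * v * cnj (klein_point p))"
    unfolding on_chord_def using s0 by simp
  also have "s * (klein_point p + u * v * cnj (klein_point p)) = s * klein_point p + u * v * (s * cnj (klein_point p))"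
    by (simp add: algebra_simps)
  also have "\<dots> = 2 * p + 2 * u * v * cnj p" unfolding k by simp
  also have "s * (u + v) = (u + v) * (1 + p * cnj p)" unfolding s by simp
  finally show ?thesis unfolding orthocircle_def by simp
qed

lemma norm_klein_point: "norm p < 1 \<Longrightarrow> norm (klein_point p) < 1"
proof -
  assume "norm p < 1"
  then have "(1 - norm p)\<^sup>2 > 0" by simp
  then have "2 * norm p < 1 + (norm p)\<^sup>2" by (simp add: power2_eq_square algebra_simps)
  moreover have "norm (klein_point p) = 2 * norm p / (1 + (norm p)\<^sup>2)"
    unfolding klein_point_def by (simp add: norm_divide norm_mult del: of_real_add)
  ultimately show ?thesis by (simp add: add_pos_nonneg)
qed

lemma klein_point_surj:
  assumes "norm k < 1"
  obtains p where "norm p < 1" "klein_point p = k"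
proof -
  define q where "q = sqrt (1 - (norm k)\<^sup>2)"
  have "(norm k)\<^sup>2 < 1" using assms by (simp add: abs_square_less_1)
  then have q: "q > 0" "(norm k)\<^sup>2 = 1 - q\<^sup>2" by (simp_all add: q_def)
  define p where "p = k / of_real (1 + q)"
  have "(norm p)\<^sup>2 = (1 - q\<^sup>2) / (1 + q)\<^sup>2" using q by (simp add: p_def norm_divide power_divide del: of_real_add)
  also have "\<dots> = (1 - q) / (1 + q)" using q(1) by (simp add: power2_eq_square divide_simps) (simp add: algebra_simps)
  finally have np: "(norm p)\<^sup>2 = (1 - q) / (1 + q)" .
  then have "(norm p)\<^sup>2 < 1" using q(1) by simp
  then have "norm p < 1" by (simp add: abs_square_less_1)
  moreover have "1 + (norm p)\<^sup>2 = 2 / (1 + q)" unfolding np using q(1) by (simp add: field_simps)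
  then have "klein_point p = k" unfolding klein_point_def p_def[symmetric]
    using q(1) by (simp add: p_def del: of_real_add) 
  ultimately show ?thesis using that by blast
qed

lemma on_chord_affine:
  assumes "norm u = 1" "norm v = 1"
  shows "on_chord u v (u + of_real t * (v - u))"
proof -
  have uc: "u * cnj u = 1" "v * cnj v = 1" using unit_cnj assms by auto
  have "u * v * cnj (u + of_real t * (v - u)) = (u * cnj u) * v + of_real t * ((v * cnj v) * u - (u * cnj u) * v)"
    by (simp add: algebra_simps)
  then show ?thesis unfolding on_chord_def uc by (simp add: algebra_simps)
qed

lemma norm_chord_affine:
  assumes "norm (u::complex) = 1" "norm v = 1"
  shows "(norm (u + of_real t * (v - u)))\<^sup>2 = 1 - t * (1 - t) * (dist u v)\<^sup>2"
proof -
  have "(norm (u + of_real t * (v - u)))\<^sup>2 = (1 - t) * (norm u)\<^sup>2 + t * (norm v)\<^sup>2 - t * (1 - t) * (dist u v)\<^sup>2"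
    unfolding dist_norm cmod_power2 by (simp add: power2_eq_square algebra_simps)
  then show ?thesis using assms by simp
qed

text \<open>
  The equation makes \<open>(k - u) / (v - u)\<close> equal to its conjugate, hence a real \<open>t\<close>. Then
  \<open>norm_chord_affine\<close> turns \<open>|k| < 1\<close> into \<open>t (1 - t) > 0\<close>.
\<close>

lemma on_chord_convex:
  assumes "norm u = 1" "norm v = 1" "u \<noteq> v" "on_chord u v k" "norm k < 1"
  obtains t where "0 < t" "t < 1" "k = u + of_real t * (v - u)"
proof -
  have uc: "u * cnj u = 1" "v * cnj v = 1" using unit_cnj assms by auto
  define w where "w = (k - u) / (v - u)"
  have w: "k = u + w * (v - u)" using assms(3) by (simp add: w_def)
  have "u * v * (cnj k - cnj u) * (v - u) = (u * v * cnj k - (u * cnj u) * v) * (v - u)" by (simp add: algebra_simps)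
  also have "\<dots> = (k - u) * (u - v)" using assms(4) unfolding uc on_chord_def by algebra
  also have "\<dots> = (k - u) * ((v * cnj v) * u - (u * cnj u) * v)" unfolding uc by simp
  also have "\<dots> = u * v * ((k - u) * (cnj v - cnj u))" by (simp add: algebra_simps)
  finally have "u * v * ((cnj k - cnj u) * (v - u)) = u * v * ((k - u) * (cnj v - cnj u))" by (simp only: mult.assoc)
  moreover have "u * v \<noteq> 0" using assms by auto
  ultimately have "(cnj k - cnj u) * (v - u) = (k - u) * (cnj v - cnj u)" by (metis mult_left_cancel)
  moreover have "cnj v - cnj u \<noteq> 0" "v - u \<noteq> 0" using assms(3) by auto
  ultimately have "cnj w = w" unfolding w_def by (simp add: frac_eq_eq)
  then have "w \<in> \<real>" by (simp add: Reals_cnj_iff)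
  then obtain t where t: "w = of_real t" by (auto elim: Reals_cases)
  have kt: "k = u + of_real t * (v - u)" using w t by simp
  have "(norm k)\<^sup>2 < 1" using assms(5) by (simp add: abs_square_less_1)
  then have "t * (1 - t) * (dist u v)\<^sup>2 > 0" unfolding kt norm_chord_affine[OF assms(1,2)] by simp
  then have "t * (1 - t) > 0" using assms(3) by (simp add: zero_less_mult_iff)
  then have "0 < t" "t < 1" by (auto simp: zero_less_mult_iff)
  then show ?thesis using kt that by blast
qed

text \<open>
  A real affine function that vanishes on the line through \<open>cis a\<close> and \<open>cis b\<close>. Its sign tells on which side of the
  line a point lies. It is the chord equation divided by the phase \<open>cis ((a + b) / 2)\<close>.
\<close>

definition chord_side :: "real \<Rightarrow> real \<Rightarrow> complex \<Rightarrow> real" where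
  "chord_side a b z = 2 * Re (z * cis (- ((a + b) / 2))) - 2 * cos ((a - b) / 2)"

lemma chord_side_iff: "on_chord (cis a) (cis b) k \<longleftrightarrow> chord_side a b k = 0"
proof -
  define g where "g = (a + b) / 2"
  define d where "d = (a - b) / 2"
  have ab: "a = g + d" "b = g - d" by (simp_all add: g_def d_def field_simps)
  define w where "w = k * cis (- g)"
  have cg: "cis g * cis (- g) = 1" by (simp add: cis_mult)
  have "complex_of_real (2 * Re w) = w + cnj w" by (simp only: complex_add_cnj)
  moreover have "complex_of_real (2 * cos d) = cis d + cis (- d)" by (simp add: complex_eq_iff)
  ultimately have "cis g * of_real (chord_side a b k) = cis g * (w + cnj w - (cis d + cis (- d)))"
    unfolding chord_side_def w_def g_def d_def by (metis minus_divide_left of_real_diff)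
  also have "\<dots> = k * (cis g * cis (- g)) + cnj k * (cis g * cis g) - cis g * cis d - cis g * cis (- d)"
    by (simp add: w_def algebra_simps cis_cnj)
  also have "\<dots> = k + cis a * cis b * cnj k - (cis a + cis b)"
    unfolding cg ab cis_mult by (simp add: algebra_simps)
  finally have "cis g * of_real (chord_side a b k) = k + cis a * cis b * cnj k - (cis a + cis b)" .
  then show ?thesis unfolding on_chord_def
    by (metis cis_neq_zero eq_iff_diff_eq_0 mult_eq_0_iff of_real_eq_0_iff)
qed

lemma chord_side_cis: "chord_side a b (cis x) = 4 * sin ((x - a) / 2) * sin ((b - x) / 2)"
proof -
  have "chord_side a b (cis x) = 2 * (cos (x - (a + b) / 2) - cos ((a - b) / 2))"
    by (simp add: chord_side_def cis_mult)
  also have "\<dots> = 4 * sin ((x - (a + b) / 2 + (a - b) / 2) / 2) * sin (((a - b) / 2 - (x - (a + b) / 2)) / 2)"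
    by (simp only: cos_diff_cos)
  also have "(x - (a + b) / 2 + (a - b) / 2) / 2 = (x - b) / 2" by (simp add: field_simps)
  also have "((a - b) / 2 - (x - (a + b) / 2)) / 2 = (a - x) / 2" by (simp add: field_simps)
  also have "4 * sin ((x - b) / 2) * sin ((a - x) / 2) = 4 * sin ((x - a) / 2) * sin ((b - x) / 2)"
  proof -
    have "sin ((x - b) / 2) = - sin ((b - x) / 2)" "sin ((a - x) / 2) = - sin ((x - a) / 2)"
      by (metis minus_diff_eq minus_divide_left sin_minus)+
    then show ?thesis by simp
  qed
  finally show ?thesis .
qed

lemma chord_side_affine:
  "chord_side a b (u + of_real t * (v - u)) = (1 - t) * chord_side a b u + t * chord_side a b v"
  unfolding chord_side_def by (simp add: algebra_simps)

text \<open>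
  The left-hand side is the determinant of the three equations in \<open>(1, k, cnj k)\<close>.
\<close>

lemma three_chords_product:
  assumes "on_chord a d k" "on_chord b e k" "on_chord c f k"
  shows "(a - b) * (c - d) * (e - f) + (b - c) * (d - e) * (f - a) = 0"
  using assms unfolding on_chord_def by algebra

text \<open>
  Up to sign, the determinant is the defect of the third equation times \<open>a d - b e\<close>. The
  latter is nonzero: otherwise the first two chords would have the same sum
  and the same product of endpoints.
\<close>

lemma third_chord:
  assumes "on_chord a d k" "on_chord b e k" "a \<noteq> b" "a \<noteq> e"
    and "(a - b) * (c - d) * (e - f) + (b - c) * (d - e) * (f - a) = 0"
  shows "on_chord c f k"
proof -
  have "(c + f - (k + c * f * cnj k)) * (a * d - b * e) = 0"
    using assms(1,2,5) unfolding on_chord_def by algebra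
  moreover have "a * d - b * e \<noteq> 0"
  proof
    assume h: "a * d - b * e = 0"
    then have "a + d = b + e" using assms(1,2) unfolding on_chord_def by (metis eq_iff_diff_eq_0)
    then have "(a - b) * (a - e) = 0" using h by algebra
    then show False using assms(3,4) by simp
  qed
  ultimately show ?thesis unfolding on_chord_def by (metis eq_iff_diff_eq_0 mult_eq_0_iff)
qed

lemma cis_diff: "cis x - cis y = 2 * \<i> * of_real (sin ((x - y) / 2)) * cis ((x + y) / 2)"
proof -
  define g where "g = (x + y) / 2"
  define d where "d = (x - y) / 2"
  have xy: "x = g + d" "y = g - d" by (simp_all add: g_def d_def field_simps)
  show ?thesis unfolding g_def[symmetric] d_def[symmetric] unfolding xy
    by (simp add: complex_eq_iff cos_add cos_diff sin_add sin_diff)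
qed

lemma dist_cis: "dist (cis x) (cis y) = 2 * \<bar>sin ((x - y) / 2)\<bar>"
  unfolding dist_norm cis_diff by (simp add: norm_mult)

section \<open>Point reflections\<close>

text \<open>
  The involution of the disk that exchanges \<open>0\<close> and \<open>k\<close>. Its centre is the point whose Klein
  image is \<open>k\<close>.
\<close>

definition point_reflection :: "complex \<Rightarrow> complex \<Rightarrow> complex" where
  "point_reflection k z = (k - z) / (1 - cnj k * z)"

lemma reflection_denominator:
  assumes "norm k < 1" "norm z \<le> 1"
  shows "1 - cnj k * z \<noteq> 0"
proof
  assume "1 - cnj k * z = 0"
  then have "norm k * norm z = 1" by (metis complex_mod_cnj norm_mult norm_one right_minus_eq)
  moreover have "norm k * norm z \<le> norm k * 1" using assms by (intro mult_left_mono) auto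
  ultimately show False using assms(1) by simp
qed

text \<open>
  This links concurrency and symmetry: the geodesics through the centre are those joining an ideal
  point to its image.
\<close>

lemma on_chord_reflection:
  assumes "norm k < 1" "norm u = 1"
  shows "on_chord u v k \<longleftrightarrow> v = point_reflection k u"
proof -
  have "on_chord u v k \<longleftrightarrow> v * (1 - cnj k * u) = k - u" unfolding on_chord_def by (auto simp: algebra_simps)
  then show ?thesis unfolding point_reflection_def 
    using reflection_denominator[of k u] assms by (simp add: eq_divide_eq)
qed

lemma reflection_norm:
  assumes "norm k < 1" "norm z \<le> 1"
  shows "norm z = 1 \<Longrightarrow> norm (point_reflection k z) = 1"
    and "norm z < 1 \<Longrightarrow> norm (point_reflection k z) < 1"
proof -
  have d0: "norm (1 - cnj k * z) > 0" using reflection_denominator[OF assms] by simp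
  have "(norm (1 - cnj k * z))\<^sup>2 - (norm (k - z))\<^sup>2 = (1 - (norm k)\<^sup>2) * (1 - (norm z)\<^sup>2)"
    unfolding cmod_power2 by (simp add: power2_eq_square algebra_simps)
  moreover have "(norm k)\<^sup>2 < 1" using assms by (simp add: abs_square_less_1)
  ultimately have e: "(norm (1 - cnj k * z))\<^sup>2 - (norm (k - z))\<^sup>2 = (1 - (norm k)\<^sup>2) * (1 - (norm z)\<^sup>2)"
    "1 - (norm k)\<^sup>2 > 0" by auto
  have q: "norm (point_reflection k z) = norm (k - z) / norm (1 - cnj k * z)"
    by (simp add: point_reflection_def norm_divide)
  show "norm (point_reflection k z) = 1" if "norm z = 1"
    using e(1) d0 unfolding q that by simp
  show "norm (point_reflection k z) < 1" if "norm z < 1"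
  proof -
    have "(norm z)\<^sup>2 < 1" using that by (simp add: abs_square_less_1)
    then have "(1 - (norm k)\<^sup>2) * (1 - (norm z)\<^sup>2) > 0" using e(2) by simp
    then have "(norm (k - z))\<^sup>2 < (norm (1 - cnj k * z))\<^sup>2" using e(1) by linarith
    then show ?thesis unfolding q using d0 by (simp add: power2_less_imp_less)
  qed
qed

lemma reflection_involution:
  assumes "norm k < 1" "norm z \<le> 1"
  shows "point_reflection k (point_reflection k z) = z"
proof -
  define d where "d = 1 - cnj k * z"
  have d0: "d \<noteq> 0" using reflection_denominator[OF assms] by (simp add: d_def)
  have e0: "1 - cnj k * k \<noteq> 0" using reflection_denominator[of k k] assms by simp
  have q: "d * ((k - z) / d) = k - z" using d0 by simp
  have "d * (k - (k - z) / d) = d * k - d * ((k - z) / d)" by (rule right_diff_distrib)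
  then have num: "d * (k - (k - z) / d) = (1 - cnj k * k) * z" unfolding q by (simp add: d_def algebra_simps)
  have "d * (1 - cnj k * ((k - z) / d)) = d - cnj k * (d * ((k - z) / d))" by (simp only: right_diff_distrib mult_1_right mult.left_commute)
  then have denom: "d * (1 - cnj k * ((k - z) / d)) = 1 - cnj k * k" unfolding q by (simp add: d_def algebra_simps)
  have "point_reflection k (point_reflection k z) = (d * (k - (k - z) / d)) / (d * (1 - cnj k * ((k - z) / d)))"
    unfolding point_reflection_def d_def[symmetric] using d0 by simp
  then show ?thesis unfolding num denom using e0 by simp
qed

text \<open>
  Clearing denominators multiplies the equation of the circle by the square of \<open>1 - k cnj k\<close>, up
  to sign.
\<close>

lemma reflection_orthocircle:
  assumes "norm k < 1" "norm u = 1" "norm v = 1" "z \<in> orthocircle u v" "norm z < 1"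
  shows "point_reflection k z \<in> orthocircle (point_reflection k u) (point_reflection k v)"
proof -
  define a b d d' where "a = 1 - cnj k * u" and "b = 1 - cnj k * v" and "d = 1 - cnj k * z" and "d' = 1 - k * cnj z"
  have nz: "a \<noteq> 0" "b \<noteq> 0" "d \<noteq> 0" using reflection_denominator assms unfolding a_def b_def d_def by auto
  have "d' = cnj d" by (simp add: d_def d'_def)
  then have nz': "d' \<noteq> 0" using nz by simp
  define w where "w = a * b * d * d'"
  have w0: "w \<noteq> 0" using nz nz' by (simp add: w_def)
  have E: "(u + v) * (1 + z * cnj z) = 2 * z + 2 * u * v * cnj z" using assms(4) by (simp add: orthocircle_def)
  let ?U = "point_reflection k u" and ?V = "point_reflection k v" and ?Z = "point_reflection k z"
  have cZ: "cnj ?Z = (cnj k - cnj z) / d'" by (simp add: point_reflection_def d'_def)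
  have U: "?U = (k - u) / a" and V: "?V = (k - v) / b" and Z: "?Z = (k - z) / d"
    by (simp_all add: point_reflection_def a_def b_def d_def)
  have clearZ: "d' * cnj ?Z = cnj k - cnj z" unfolding cZ using nz' by simp
  have "d * ?Z = k - z" "a * ?U = k - u" "b * ?V = k - v" unfolding U V Z using nz by simp_all
  note clear = this clearZ
  have 1: "w * ((?U + ?V) * (1 + ?Z * cnj ?Z)) = ((k - u) * b + (k - v) * a) * (d * d' + (k - z) * (cnj k - cnj z))"
  proof -
    have "a * b * (?U + ?V) = (a * ?U) * b + (b * ?V) * a" by (simp only: distrib_left mult.assoc mult.commute mult.left_commute)
    then have p: "a * b * (?U + ?V) = (k - u) * b + (k - v) * a" unfolding clear .
    have "d * d' * (1 + ?Z * cnj ?Z) = d * d' + (d * ?Z) * (d' * cnj ?Z)"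
      by (simp only: distrib_left mult_1 mult_1_right mult.assoc mult.commute mult.left_commute)
    then have q: "d * d' * (1 + ?Z * cnj ?Z) = d * d' + (k - z) * (cnj k - cnj z)" unfolding clear .
    have "w * ((?U + ?V) * (1 + ?Z * cnj ?Z)) = (a * b * (?U + ?V)) * (d * d' * (1 + ?Z * cnj ?Z))"
      unfolding w_def by (simp only: mult.assoc mult.commute mult.left_commute)
    then show ?thesis unfolding p q .
  qed
  have 2: "w * (2 * ?Z + 2 * ?U * ?V * cnj ?Z) = 2 * (k - z) * a * b * d' + 2 * (k - u) * (k - v) * (cnj k - cnj z) * d"
  proof -
    have "w * (2 * ?Z + 2 * ?U * ?V * cnj ?Z) = 2 * (d * ?Z) * a * b * d' + 2 * (a * ?U) * (b * ?V) * (d' * cnj ?Z) * d"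
      unfolding w_def distrib_left by (simp only: mult.assoc mult.commute mult.left_commute)
    then show ?thesis unfolding clear .
  qed
  have "((k - u) * b + (k - v) * a) * (d * d' + (k - z) * (cnj k - cnj z))
    = 2 * (k - z) * a * b * d' + 2 * (k - u) * (k - v) * (cnj k - cnj z) * d"
  proof -
    \<comment> \<open>Everything is expressed through \<open>u + v\<close>, \<open>u * v\<close> and \<open>1 + z * cnj z\<close>.\<close>
    have poly: "(2 * k - S * (1 + k * k') + 2 * k' * P) * ((1 + k * k') * t - 2 * k' * z - 2 * k * z')
      - (2 * (k * t - z - k * k * z') * (1 - k' * S + k' * k' * P) + 2 * (k * k - k * S + P) * (k' * t - z' - k' * k' * z))
      = - ((1 - k * k') * (1 - k * k') * (S * t - (2 * z + 2 * P * z')))" for k' z' S P t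
      by (simp add: algebra_simps)
    have e1: "(k - u) * b + (k - v) * a = 2 * k - (u + v) * (1 + k * cnj k) + 2 * cnj k * (u * v)"
      by (simp add: a_def b_def algebra_simps)
    have e2: "d * d' + (k - z) * (cnj k - cnj z) = (1 + k * cnj k) * (1 + z * cnj z) - 2 * cnj k * z - 2 * k * cnj z"
      by (simp add: d_def d'_def algebra_simps)
    have e3: "a * b = 1 - cnj k * (u + v) + cnj k * cnj k * (u * v)" by (simp add: a_def b_def algebra_simps)
    have e4: "(k - z) * d' = k * (1 + z * cnj z) - z - k * k * cnj z" by (simp add: d'_def algebra_simps)
    have e5: "(cnj k - cnj z) * d = cnj k * (1 + z * cnj z) - cnj z - cnj k * cnj k * z" by (simp add: d_def algebra_simps)
    have e6: "(k - u) * (k - v) = k * k - k * (u + v) + u * v" by (simp add: algebra_simps)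
    have "2 * (k - z) * a * b * d' + 2 * (k - u) * (k - v) * (cnj k - cnj z) * d
      = 2 * ((k - z) * d') * (a * b) + 2 * ((k - u) * (k - v)) * ((cnj k - cnj z) * d)"
      by (simp only: mult.assoc mult.commute mult.left_commute)
    moreover have "(u + v) * (1 + z * cnj z) - (2 * z + 2 * (u * v) * cnj z) = 0" using E by (simp add: mult.assoc)
    ultimately show ?thesis using poly[of "u + v" "cnj k" "u * v" "1 + z * cnj z" "cnj z"]
      unfolding e1 e2 e3 e4 e5 e6 by simp
  qed
  then have "w * ((?U + ?V) * (1 + ?Z * cnj ?Z)) = w * (2 * ?Z + 2 * ?U * ?V * cnj ?Z)" unfolding 1 2 .
  then show ?thesis unfolding orthocircle_def using w0 by simp
qed

lemma reflection_hyp_isometry: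
  assumes "norm k < 1"
  shows "hyp_isometry (point_reflection k)"
proof -
  have 1: "lin_frac (-1) k (- cnj k) 1 = point_reflection k"
    by (intro ext) (simp add: lin_frac_def point_reflection_def)
  have 2: "lin_frac 1 (- k) (- (- cnj k)) (-1) = point_reflection k"
  proof
    fix z
    have "1 * z + - k = - (k - z)" "- (- cnj k) * z + - 1 = - (1 - cnj k * z)" by simp_all
    then show "lin_frac 1 (- k) (- (- cnj k)) (-1) z = point_reflection k z"
      unfolding point_reflection_def lin_frac_def by (simp only: minus_divide_divide)
  qed
  have "1 - cnj k * k \<noteq> 0" using reflection_denominator[of k k] assms by simp
  then have det: "(-1) * 1 - k * (- cnj k) \<noteq> 0" by (simp add: algebra_simps)
  have p1: "lin_frac_preserves_plane (-1) k (- cnj k) 1"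
    unfolding lin_frac_preserves_plane_def 1
    using reflection_denominator[OF assms] reflection_norm(2)[OF assms] by auto
  have p2: "lin_frac_preserves_plane 1 (- k) (- (- cnj k)) (-1)"
    unfolding lin_frac_preserves_plane_def 2
    using reflection_denominator[OF assms] reflection_norm(2)[OF assms] by fastforce
  show ?thesis unfolding hyp_isometry_def using det p1 p2 1 by metis
qed

text \<open>
  A fixed point satisfies \<open>k + cnj k z\<^sup>2 = 2 z\<close>, which the Poincare point of \<open>k\<close> solves. Two solutions
  would give \<open>cnj k (z + p) = 2\<close>, impossible inside the disk.
\<close>

lemma reflection_fixed:
  assumes "norm k < 1"
  shows "\<exists>!z. z \<in> hyp_plane \<and> point_reflection k z = z"
proof -
  have fix_iff: "point_reflection k z = z \<longleftrightarrow> k + cnj k * (z * z) = 2 * z" if "norm z < 1" for z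
    unfolding point_reflection_def using reflection_denominator[of k z] assms that
    by (auto simp: divide_eq_eq algebra_simps)
  obtain p where p: "norm p < 1" "klein_point p = k" using klein_point_surj assms by blast
  define s where "s = complex_of_real (1 + (norm p)\<^sup>2)"
  have s: "s = 1 + p * cnj p" "cnj s = s" unfolding s_def by (simp_all add: of_real_norm_sq[symmetric] del: of_real_power)
  have "1 + (norm p)\<^sup>2 \<noteq> 0" by (metis add_pos_nonneg less_irrefl zero_le_power2 zero_less_one)
  then have s0: "s \<noteq> 0" unfolding s_def of_real_eq_0_iff .
  have k: "s * k = 2 * p" "s * cnj k = 2 * cnj p"
    unfolding p(2)[symmetric] klein_point_def s_def[symmetric] using s0 s(2) by simp_all
  have "s * (k + cnj k * (p * p)) = s * k + (s * cnj k) * (p * p)" by (simp add: algebra_simps)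
  also have "\<dots> = s * (2 * p)" unfolding k unfolding s by (simp add: algebra_simps)
  finally have "k + cnj k * (p * p) = 2 * p" using s0 by (metis mult_left_cancel)
  then have fixp: "point_reflection k p = p" using fix_iff[OF p(1)] by blast
  have uniq: "z = p" if z: "norm z < 1" "k + cnj k * (z * z) = 2 * z" for z
  proof (rule ccontr)
    assume "z \<noteq> p"
    have "(cnj k * (z + p)) * (z - p) = 2 * (z - p)" using z(2) \<open>k + cnj k * (p * p) = 2 * p\<close> by algebra
    then have "cnj k * (z + p) = 2" using \<open>z \<noteq> p\<close> by (metis mult_right_cancel right_minus_eq)
    then have "norm k * norm (z + p) = 2" by (metis complex_mod_cnj norm_mult norm_numeral)
    moreover have "norm (z + p) < 2" using norm_triangle_ineq[of z p] z(1) p(1) by linarith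
    then have "norm k * norm (z + p) < 1 * 2" using assms by (intro mult_strict_mono) auto
    ultimately show False by simp
  qed
  show ?thesis
  proof (rule ex1I[of _ p])
    show "p \<in> hyp_plane \<and> point_reflection k p = p" using fixp p(1) by simp
    fix z assume "z \<in> hyp_plane \<and> point_reflection k z = z"
    then have "norm z < 1" "point_reflection k z = z" by simp_all
    then show "z = p" using uniq fix_iff by blast
  qed
qed

text \<open>
  From \<open>T (T z) = z\<close> one gets \<open>(a + d) (b + (a - d) z - c z\<^sup>2) = 0\<close> on the disk, so \<open>d = - a\<close> unless
  \<open>T\<close> is the identity. Then \<open>T\<close> maps the unit circle to itself, since a boundary point sent inside would be
  brought back to the boundary by the second application. Comparing \<open>|a z + b| = |c z - a|\<close> at \<open>1\<close>, \<open>- 1\<close>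
  and \<open>\<i>\<close> yields \<open>a cnj b = - c cnj a\<close>, which identifies \<open>T\<close> with the reflection for
  \<open>k = T 0 = - b / a\<close>.
\<close>

lemma involution_is_reflection:
  assumes iso: "hyp_isometry T" and nt: "z0 \<in> hyp_plane" "T z0 \<noteq> z0"
    and inv: "\<forall>z \<in> hyp_plane. T (T z) = z"
  obtains k where "norm k < 1" "T = point_reflection k"
proof -
  obtain a b c d where det: "a * d - b * c \<noteq> 0" and T: "T = lin_frac a b c d"
    and pr: "lin_frac_preserves_plane a b c d"
    using iso unfolding hyp_isometry_def by blast
  have den: "c * z + d \<noteq> 0" "norm (T z) < 1" if "norm z < 1" for z
    using pr that unfolding lin_frac_preserves_plane_def T by auto
  have Tz: "T z = (a * z + b) / (c * z + d)" for z by (simp add: T lin_frac_def)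
  have "(a + d) * (b + (a - d) * z - c * (z * z)) = 0" if z: "norm z < 1" for z
  proof -
    have 1: "T z * (c * z + d) = a * z + b" using den[OF z] by (simp add: Tz)
    have "T (T z) * (c * T z + d) = a * T z + b" using den(1)[OF den(2)[OF z]] Tz[of "T z"] by simp
    then have 2: "z * (c * T z + d) = a * T z + b" using inv z by simp
    show ?thesis using 1 2 by algebra
  qed
  moreover have "b + (a - d) * z0 - c * (z0 * z0) \<noteq> 0"
  proof
    assume "b + (a - d) * z0 - c * (z0 * z0) = 0"
    then have "a * z0 + b = z0 * (c * z0 + d)" by algebra
    then have "T z0 = z0" using den(1)[of z0] nt(1) by (simp add: Tz)
    then show False using nt(2) by simp
  qed
  ultimately have "a + d = 0" using nt(1) by force
  then have d: "d = - a" by (metis add_eq_0_iff)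
  have a0: "a \<noteq> 0" using den(1)[of 0] d by auto
  have le: "norm (a * z + b) \<le> norm (c * z - a)" if z: "norm z \<le> 1" for z
  proof -
    have "norm (a * w + b) \<le> norm (c * w - a)" if "w \<in> ball 0 1" for w
      using den[of w] that unfolding Tz d by (simp add: norm_divide)
    then have "0 \<le> norm (c * w - a) - norm (a * w + b)" if "w \<in> ball 0 1" for w using that by simp
    moreover have "continuous_on (closure (ball 0 1)) (\<lambda>w. norm (c * w - a) - norm (a * w + b))"
      by (intro continuous_intros)
    moreover have "z \<in> closure (ball 0 1)" using z by simp
    ultimately have "0 \<le> norm (c * z - a) - norm (a * z + b)"
      using continuous_ge_on_closure[of "ball 0 1" "\<lambda>w. norm (c * w - a) - norm (a * w + b)" z 0] by blast
    then show ?thesis by simp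
  qed
  have eq: "norm (a * z + b) = norm (c * z - a)" if z: "norm z = 1" for z
  proof (rule ccontr)
    assume "norm (a * z + b) \<noteq> norm (c * z - a)"
    then have lt: "norm (a * z + b) < norm (c * z - a)" using le[of z] z by simp
    then have n0: "c * z - a \<noteq> 0" by auto
    define w where "w = (a * z + b) / (c * z - a)"
    have w1: "norm w < 1" using lt n0 by (simp add: w_def norm_divide)
    have e: "w * (c * z - a) = a * z + b" using n0 by (simp add: w_def)
    then have "z * (c * w - a) = a * w + b" by algebra
    then have "T w = z" using den(1)[OF w1] by (simp add: Tz d divide_eq_eq)
    then show False using den(2)[OF w1] z by simp
  qed
  have sq: "Re (a * cnj b * z) + Re (c * cnj a * z) = ((norm c)\<^sup>2 - (norm b)\<^sup>2) / 2" if z: "norm z = 1" for z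
  proof -
    have ex: "(norm (p * z + q))\<^sup>2 = (norm p)\<^sup>2 + (norm q)\<^sup>2 + 2 * Re (p * cnj q * z)" for p q
    proof -
      have "(norm (p * z + q))\<^sup>2 = (norm (p * z))\<^sup>2 + (norm q)\<^sup>2 + 2 * Re (p * cnj q * z)"
        unfolding cmod_power2 by (simp add: power2_eq_square algebra_simps)
      then show ?thesis using z by (simp add: norm_mult)
    qed
    have "(norm (a * z + b))\<^sup>2 = (norm (c * z + (- a)))\<^sup>2" using eq[OF z] by simp
    then show ?thesis unfolding ex by simp
  qed
  have "Re (a * cnj b) + Re (c * cnj a) = 0" "Im (a * cnj b) + Im (c * cnj a) = 0"
    using sq[of 1] sq[of "-1"] sq[of "\<i>"] by simp_all
  then have "a * cnj b + c * cnj a = 0" by (simp add: complex_eq_iff)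
  define k where "k = - (b / a)"
  have "T 0 = k" by (simp add: Tz d k_def)
  then have k1: "norm k < 1" using den(2)[of 0] by simp
  have c: "c = a * cnj k"
  proof -
    have "c * cnj a = - (a * cnj b)" using \<open>a * cnj b + c * cnj a = 0\<close> by (metis add_eq_0_iff)
    then show ?thesis using a0 by (simp add: k_def field_simps)
  qed
  have b: "b = - (a * k)" using a0 by (simp add: k_def)
  have "T z = point_reflection k z" for z
  proof -
    have "a * z + b = (- a) * (k - z)" "c * z + d = (- a) * (1 - cnj k * z)"
      unfolding b c d by (simp_all add: algebra_simps)
    then show ?thesis unfolding Tz point_reflection_def using a0 by simp
  qed
  then show ?thesis using that k1 by blast
qed

section \<open>Hexagons\<close>

text \<open>
  The involution exchanges the indices strictly between \<open>i\<close> and \<open>p i\<close> with those outside. These two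
  sets have four elements in total, so each has two.
\<close>

lemma crossing_involution_is_antipodal:
  assumes p: "\<And>i. i \<in> {1..6} \<Longrightarrow> p i \<in> {1..6::nat} \<and> p i \<noteq> i \<and> p (p i) = i"
    and cross: "\<And>i j. i \<in> {1..6} \<Longrightarrow> j \<in> {1..6} \<Longrightarrow> j \<noteq> i \<Longrightarrow> j \<noteq> p i \<Longrightarrow>
      (j \<in> {min i (p i)<..<max i (p i)}) \<noteq> (p j \<in> {min i (p i)<..<max i (p i)})"
    and i: "i \<in> {1..6}"
  shows "p i = i + 3 \<or> i = p i + 3"
proof -
  define B where "B = {min i (p i)<..<max i (p i)}"
  define R where "R = {1..6} - (B \<union> {i, p i})"
  have pi: "p i \<in> {1..6}" "p i \<noteq> i" "p (p i) = i" using p[OF i] by auto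
  have Bsub: "B \<subseteq> {1..6}" using i pi(1) unfolding B_def by auto
  have Bi: "i \<notin> B" "p i \<notin> B" unfolding B_def by auto
  have inj: "inj_on p {1..6}" by (metis inj_onI p)
  have im: "p j \<in> (if j \<in> B then R else B)" if j: "j \<in> B \<union> R" for j
  proof -
    have j6: "j \<in> {1..6}" "j \<noteq> i" "j \<noteq> p i" using j Bsub Bi unfolding R_def by blast+
    have "p j \<in> {1..6}" "p j \<noteq> i" "p j \<noteq> p i" using p[OF j6(1)] j6 pi i by metis+
    then show ?thesis using cross[OF i j6] unfolding B_def[symmetric] R_def by auto
  qed
  have Rsub: "R \<subseteq> {1..6}" unfolding R_def by blast
  have disj: "j \<notin> B" if "j \<in> R" for j using that unfolding R_def by blast
  have "p ` B \<subseteq> R" using im by (metis UnI1 image_subsetI)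
  then have "card B \<le> card R" using inj Bsub Rsub by (metis card_inj_on_le finite_atLeastAtMost finite_subset inj_on_subset)
  moreover have "p ` R \<subseteq> B" using im disj by (metis UnI2 image_subsetI)
  then have "card R \<le> card B" using inj Bsub Rsub by (metis card_inj_on_le finite_atLeastAtMost finite_subset inj_on_subset)
  ultimately have BR: "card R = card B" by simp
  have finB: "finite B" unfolding B_def by simp
  have "card (B \<union> {i, p i}) = card B + 2" using Bi pi(2) finB by simp
  moreover have "card R = card {1..6::nat} - card (B \<union> {i, p i})"
    unfolding R_def using finB Bsub i pi(1) by (intro card_Diff_subset) auto
  ultimately have "card R = 4 - card B" by simp
  then have "card B = 4 - card B" using BR by simp
  moreover have "card B = max i (p i) - min i (p i) - 1" unfolding B_def by simp
  ultimately show ?thesis by (auto simp: max_def min_def split: if_splits)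
qed

text \<open>
  An ideal hexagon with its angles named. The sign \<open>\<sigma>\<close> comes out of every sine as a factor, so
  both orientations are treated at once.
\<close>

locale cyclic_hexagon =
  fixes v :: "nat \<Rightarrow> complex" and \<theta> :: "nat \<Rightarrow> real" and \<sigma> :: real
  assumes orientation: "\<sigma> \<in> {1, - 1}"
    and increasing: "strict_mono_on {1..6} \<theta>"
    and one_turn: "\<theta> 6 < \<theta> 1 + 2 * pi"
    and vertex: "\<And>k. k \<in> {1..6} \<Longrightarrow> v k = cis (\<sigma> * \<theta> k)"
begin

text \<open>
  Half the Euclidean distance of two vertices, with the sign of \<open>j - i\<close>.
\<close>

definition gap :: "nat \<Rightarrow> nat \<Rightarrow> real" where
  "gap i j = sin ((\<theta> j - \<theta> i) / 2)"

lemma gap_swap: "gap j i = - gap i j"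
  unfolding gap_def by (metis minus_diff_eq minus_divide_left sin_minus)

lemma gap_pos:
  assumes "i \<in> {1..6}" "j \<in> {1..6}" "i < j"
  shows "gap i j > 0"
proof -
  have "\<theta> i < \<theta> j" using increasing assms by (simp add: strict_mono_onD)
  moreover have "\<theta> 1 \<le> \<theta> i" "\<theta> j \<le> \<theta> 6"
    using strict_mono_on_leD[OF increasing, of 1 i] strict_mono_on_leD[OF increasing, of j 6] assms by auto
  ultimately show ?thesis unfolding gap_def using one_turn by (intro sin_gt_zero) auto
qed

lemma sin_orientation: "sin (\<sigma> * x / 2) = \<sigma> * sin (x / 2)"
  using orientation by auto

lemma orientation_sq: "\<sigma> * \<sigma> = 1" "\<bar>\<sigma>\<bar> = 1"
  using orientation by auto

lemma norm_vertex: "k \<in> {1..6} \<Longrightarrow> norm (v k) = 1"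
  by (simp add: vertex)

lemma sin_vertex: "sin ((\<sigma> * \<theta> j - \<sigma> * \<theta> i) / 2) = \<sigma> * gap i j"
  unfolding gap_def right_diff_distrib[symmetric] by (rule sin_orientation)

lemma dist_vertex:
  assumes "i \<in> {1..6}" "j \<in> {1..6}"
  shows "dist (v i) (v j) = 2 * \<bar>gap i j\<bar>"
  using dist_cis[of "\<sigma> * \<theta> j" "\<sigma> * \<theta> i"] orientation_sq(2) assms
  by (simp add: vertex sin_vertex abs_mult dist_commute)

lemma vertex_distinct:
  assumes "i \<in> {1..6}" "j \<in> {1..6}" "i \<noteq> j"
  shows "v i \<noteq> v j"
proof -
  have "gap i j \<noteq> 0" using gap_pos[of i j] gap_pos[of j i] gap_swap[of i j] assms by (cases "i < j") auto
  then have "dist (v i) (v j) \<noteq> 0" using dist_vertex assms by simp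
  then show ?thesis by simp
qed

lemma inj_vertex: "inj_on v {1..6}"
  using vertex_distinct by (meson inj_onI)

lemma chord_side_vertex:
  assumes "i \<in> {1..6}" "j \<in> {1..6}" "m \<in> {1..6}"
  shows "chord_side (\<sigma> * \<theta> i) (\<sigma> * \<theta> j) (v m) = 4 * gap i m * gap m j"
  using orientation_sq(1) assms by (simp add: vertex chord_side_cis sin_vertex)

lemma chord_side_sign:
  assumes "i \<in> {1..6}" "j \<in> {1..6}" "m \<in> {1..6}" "m \<noteq> i" "m \<noteq> j"
  shows "m \<in> {min i j<..<max i j} \<Longrightarrow> chord_side (\<sigma> * \<theta> i) (\<sigma> * \<theta> j) (v m) > 0"
    and "m \<notin> {min i j<..<max i j} \<Longrightarrow> chord_side (\<sigma> * \<theta> i) (\<sigma> * \<theta> j) (v m) < 0"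
proof -
  have s: "gap a b > 0 \<longleftrightarrow> a < b" "gap a b < 0 \<longleftrightarrow> b < a" if "a \<in> {1..6}" "b \<in> {1..6}" "a \<noteq> b" for a b
    using gap_pos[of a b] gap_pos[of b a] gap_swap[of a b] that by (cases "a < b"; auto)+
  note sim = s[OF assms(1,3) assms(4)[symmetric]] and smj = s[OF assms(3,2,5)]
  show "chord_side (\<sigma> * \<theta> i) (\<sigma> * \<theta> j) (v m) > 0" if "m \<in> {min i j<..<max i j}"
    unfolding chord_side_vertex[OF assms(1-3)] using that sim smj 
    by (auto simp: zero_less_mult_iff min_def max_def split: if_splits)
  show "chord_side (\<sigma> * \<theta> i) (\<sigma> * \<theta> j) (v m) < 0" if "m \<notin> {min i j<..<max i j}"
    unfolding chord_side_vertex[OF assms(1-3)] using that sim smj assms(4,5)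
    by (auto simp: mult_less_0_iff min_def max_def split: if_splits)
qed

text \<open>
  Two chords through a common interior point: the point lies strictly between \<open>v j\<close> and \<open>v j'\<close>
  on the second, and \<open>chord_side\<close> of the first vanishes there, so it has opposite signs at
  \<open>v j\<close> and \<open>v j'\<close>.
\<close>

lemma chords_cross:
  assumes "i \<in> {1..6}" "i' \<in> {1..6}" "i \<noteq> i'" "j \<in> {1..6}" "j' \<in> {1..6}" "j \<noteq> j'" "j \<notin> {i, i'}" "j' \<notin> {i, i'}"
    and k: "norm k < 1" "on_chord (v i) (v i') k" "on_chord (v j) (v j') k"
  shows "(j \<in> {min i i'<..<max i i'}) \<noteq> (j' \<in> {min i i'<..<max i i'})"
proof -
  let ?f = "chord_side (\<sigma> * \<theta> i) (\<sigma> * \<theta> i')"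
  obtain t where t: "0 < t" "t < 1" "k = v j + of_real t * (v j' - v j)"
    using on_chord_convex[OF norm_vertex norm_vertex vertex_distinct k(3,1)] assms by metis
  have "?f k = 0" using k(2) assms(1,2) by (simp add: vertex chord_side_iff)
  then have z: "(1 - t) * ?f (v j) + t * ?f (v j') = 0" unfolding t(3) chord_side_affine .
  have "\<not> (?f (v j) > 0 \<and> ?f (v j') > 0)" using z t by (smt (verit) mult_pos_pos)
  moreover have "\<not> (?f (v j) < 0 \<and> ?f (v j') < 0)" using z t by (smt (verit) mult_pos_neg)
  moreover note chord_side_sign[of i i' j] chord_side_sign[of i i' j']
  ultimately show ?thesis using assms by blast
qed

lemma concurrent_iff:
  "opposite_geodesics_concurrent v \<longleftrightarrow>
     (\<exists>k. norm k < 1 \<and> on_chord (v 1) (v 4) k \<and> on_chord (v 2) (v 5) k \<and> on_chord (v 3) (v 6) k)"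
proof -
  have g: "p \<in> geodesic_joining (v i) (v j) \<longleftrightarrow> norm p < 1 \<and> on_chord (v i) (v j) (klein_point p)"
    if "i \<in> {1..6}" "j \<in> {1..6}" "i \<noteq> j" for p i j
    using geodesic_joining_eq[OF norm_vertex norm_vertex vertex_distinct, of i j] that orthocircle_klein_point
    by auto
  have iff: "opposite_geodesics_concurrent v \<longleftrightarrow>
     (\<exists>p. norm p < 1 \<and> on_chord (v 1) (v 4) (klein_point p) \<and> on_chord (v 2) (v 5) (klein_point p) \<and> on_chord (v 3) (v 6) (klein_point p))"
    unfolding opposite_geodesics_concurrent_def using g[of 1 4] g[of 2 5] g[of 3 6] by auto
  show ?thesis unfolding iff
  proof
    assume "\<exists>k. norm k < 1 \<and> on_chord (v 1) (v 4) k \<and> on_chord (v 2) (v 5) k \<and> on_chord (v 3) (v 6) k"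
    then obtain k where k: "norm k < 1" "on_chord (v 1) (v 4) k \<and> on_chord (v 2) (v 5) k \<and> on_chord (v 3) (v 6) k"
      by blast
    obtain p where "norm p < 1" "klein_point p = k" using klein_point_surj[OF k(1)] .
    then show "\<exists>p. norm p < 1 \<and> on_chord (v 1) (v 4) (klein_point p) \<and> on_chord (v 2) (v 5) (klein_point p) \<and> on_chord (v 3) (v 6) (klein_point p)"
      using k(2) by blast
  qed (use norm_klein_point in blast)
qed

text \<open>
  The vertices \<open>v 1\<close> and \<open>v 4\<close> lie on different sides of the chord from \<open>v 2\<close> to \<open>v 5\<close>. The point
  where \<open>chord_side\<close> vanishes is found by linear interpolation.
\<close>

lemma diagonals_meet:
  obtains k where "norm k < 1" "on_chord (v 1) (v 4) k" "on_chord (v 2) (v 5) k"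
proof -
  let ?f = "chord_side (\<sigma> * \<theta> 2) (\<sigma> * \<theta> 5)"
  have s1: "?f (v 1) < 0" using chord_side_sign(2)[of 2 5 1] by simp
  have s4: "?f (v 4) > 0" using chord_side_sign(1)[of 2 5 4] by simp
  define t where "t = ?f (v 1) / (?f (v 1) - ?f (v 4))"
  have t: "0 < t" "t < 1" unfolding t_def using s1 s4 by (auto simp: field_simps)
  define k where "k = v 1 + of_real t * (v 4 - v 1)"
  have "(1 - t) * ?f (v 1) + t * ?f (v 4) = ?f (v 1) - t * (?f (v 1) - ?f (v 4))" by (simp add: algebra_simps)
  also have "\<dots> = 0" unfolding t_def using s1 s4 by simp
  finally have "?f k = 0" unfolding k_def chord_side_affine .
  then have "on_chord (v 2) (v 5) k" by (simp add: vertex chord_side_iff)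
  moreover have "on_chord (v 1) (v 4) k" unfolding k_def by (intro on_chord_affine norm_vertex) auto
  moreover have "(norm k)\<^sup>2 < 1"
    unfolding k_def using norm_chord_affine[of "v 1" "v 4" t] norm_vertex[of 1] norm_vertex[of 4] t vertex_distinct[of 1 4] by simp
  then have "norm k < 1" by (simp add: abs_square_less_1)
  ultimately show ?thesis using that by blast
qed

lemma vertex_diff:
  assumes "i \<in> {1..6}" "j \<in> {1..6}"
  shows "v i - v j = (- 2 * \<i> * of_real \<sigma>) * of_real (gap i j) * (cis (\<sigma> * \<theta> i / 2) * cis (\<sigma> * \<theta> j / 2))"
proof -
  have "cis ((\<sigma> * \<theta> i + \<sigma> * \<theta> j) / 2) = cis (\<sigma> * \<theta> i / 2) * cis (\<sigma> * \<theta> j / 2)"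
    by (simp add: cis_mult add_divide_distrib)
  then show ?thesis using assms cis_diff[of "\<sigma> * \<theta> i" "\<sigma> * \<theta> j"] sin_vertex[of i j] gap_swap[of i j]
    by (simp add: vertex sin_vertex)
qed

text \<open>
  All six phases occur in both products of the determinant. Since \<open>gap 6 1 = - gap 1 6\<close>, what remains is a
  difference of positive real numbers.
\<close>

lemma concurrent_iff_gaps:
  "opposite_geodesics_concurrent v \<longleftrightarrow> gap 1 2 * gap 3 4 * gap 5 6 = gap 2 3 * gap 4 5 * gap 1 6"
proof -
  define h where "h = (\<lambda>i::nat. cis (\<sigma> * \<theta> i / 2))"
  define H where "H = h 1 * h 2 * h 3 * h 4 * h 5 * h 6"
  define c where "c = - 2 * \<i> * complex_of_real \<sigma>"
  have c0: "c \<noteq> 0" using orientation by (auto simp: c_def)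
  have H0: "H \<noteq> 0" by (simp add: H_def h_def)
  have d: "v i - v j = c * of_real (gap i j) * (h i * h j)" if "i \<in> {1..6}" "j \<in> {1..6}" for i j
    using vertex_diff[OF that] by (simp add: c_def h_def)
  have D: "v 1 - v 2 = c * of_real (gap 1 2) * (h 1 * h 2)" "v 3 - v 4 = c * of_real (gap 3 4) * (h 3 * h 4)"
     "v 5 - v 6 = c * of_real (gap 5 6) * (h 5 * h 6)" "v 2 - v 3 = c * of_real (gap 2 3) * (h 2 * h 3)"
     "v 4 - v 5 = c * of_real (gap 4 5) * (h 4 * h 5)" "v 6 - v 1 = c * (- of_real (gap 1 6)) * (h 6 * h 1)"
    using d[of 1 2] d[of 3 4] d[of 5 6] d[of 2 3] d[of 4 5] d[of 6 1] gap_swap[of 6 1] by simp_all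
  have "(v 1 - v 2) * (v 3 - v 4) * (v 5 - v 6) + (v 2 - v 3) * (v 4 - v 5) * (v 6 - v 1)
    = c * c * c * H * of_real (gap 1 2 * gap 3 4 * gap 5 6 - gap 2 3 * gap 4 5 * gap 1 6)"
    unfolding D H_def by (simp add: algebra_simps)
  then have prod: "(v 1 - v 2) * (v 3 - v 4) * (v 5 - v 6) + (v 2 - v 3) * (v 4 - v 5) * (v 6 - v 1) = 0
    \<longleftrightarrow> gap 1 2 * gap 3 4 * gap 5 6 = gap 2 3 * gap 4 5 * gap 1 6" 
    using c0 H0 by (metis (no_types, lifting) eq_iff_diff_eq_0 mult_eq_0_iff of_real_eq_0_iff)
  show ?thesis
  proof
    assume "opposite_geodesics_concurrent v"
    then show "gap 1 2 * gap 3 4 * gap 5 6 = gap 2 3 * gap 4 5 * gap 1 6"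
      using concurrent_iff three_chords_product prod by blast
  next
    assume g: "gap 1 2 * gap 3 4 * gap 5 6 = gap 2 3 * gap 4 5 * gap 1 6"
    obtain k where k: "norm k < 1" "on_chord (v 1) (v 4) k" "on_chord (v 2) (v 5) k" using diagonals_meet .
    have "on_chord (v 3) (v 6) k"
      using third_chord[OF k(2,3)] vertex_distinct[of 1 2] vertex_distinct[of 1 5] g prod by simp
    then show "opposite_geodesics_concurrent v" using k concurrent_iff by blast
  qed
qed

lemma concurrent_iff_perimeter:
  "opposite_geodesics_concurrent v \<longleftrightarrow> alternating_perimeter v = 0"
proof -
  have g: "gap 1 2 > 0" "gap 2 3 > 0" "gap 3 4 > 0" "gap 4 5 > 0" "gap 5 6 > 0" "gap 1 6 > 0"
    by (simp_all add: gap_pos)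
  have l: "ln ((dist (v i) (v j))\<^sup>2) = ln 4 + 2 * ln (gap i j)" if "i \<in> {1..6}" "j \<in> {1..6}" "gap i j > 0" for i j
    using that by (simp add: dist_vertex ln_realpow ln_mult)
  have l6: "ln ((dist (v 6) (v 1))\<^sup>2) = ln 4 + 2 * ln (gap 1 6)"
    using l[of 1 6] g(6) by (simp add: dist_commute)
  have "alternating_perimeter v = 2 * (ln (gap 1 2) + ln (gap 3 4) + ln (gap 5 6) - (ln (gap 2 3) + ln (gap 4 5) + ln (gap 1 6)))"
    using alternating_perimeter_eq[OF norm_vertex inj_vertex] l6 l[of 1 2] l[of 2 3] l[of 3 4] l[of 4 5] l[of 5 6] g by simp
  also have "\<dots> = 2 * (ln (gap 1 2 * gap 3 4 * gap 5 6) - ln (gap 2 3 * gap 4 5 * gap 1 6))"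
    using g by (simp add: ln_mult)
  finally have "alternating_perimeter v = 0 \<longleftrightarrow> ln (gap 1 2 * gap 3 4 * gap 5 6) = ln (gap 2 3 * gap 4 5 * gap 1 6)"
    by simp
  also have "\<dots> \<longleftrightarrow> gap 1 2 * gap 3 4 * gap 5 6 = gap 2 3 * gap 4 5 * gap 1 6"
    using g by (intro ln_inj_iff) simp_all
  finally show ?thesis using concurrent_iff_gaps by simp
qed

lemma side_eq:
  assumes "i \<in> {1..6}"
  shows "side v i = orthocircle (v i) (v (next_index i)) \<inter> hyp_plane"
proof -
  have "next_index i \<in> {1..6}" "i \<noteq> next_index i" using assms by (auto simp: next_index_def)
  then show ?thesis unfolding side_def using geodesic_joining_eq norm_vertex vertex_distinct assms by simp
qed

text \<open>
  The symmetry permutes the vertices, because they are the points of the closed curve on the unit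
  circle. The chords joining each vertex to its image all pass through \<open>k\<close> and cross
  pairwise, so images are opposite vertices.
\<close>

lemma symmetric_imp_concurrent:
  assumes "point_reflection_symmetry (hexagon_loop v)"
  shows "opposite_geodesics_concurrent v"
proof -
  let ?P = "hexagon_loop v"
  obtain T z0 where T: "hyp_isometry T" "z0 \<in> hyp_plane" "T z0 \<noteq> z0" "\<forall>z\<in>hyp_plane. T (T z) = z" "T ` ?P = ?P"
    using assms unfolding point_reflection_symmetry_def by blast
  obtain k where k: "norm k < 1" "T = point_reflection k" using involution_is_reflection[OF T(1-4)] .
  have "\<exists>j\<in>{1..6}. T (v i) = v j" if i: "i \<in> {1..6}" for i
  proof -
    have "v i \<in> ?P" using i unfolding hexagon_loop_def by blast
    then have "T (v i) \<in> ?P" using T(5) by blast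
    moreover have "norm (T (v i)) = 1" unfolding k(2) using reflection_norm(1)[OF k(1)] norm_vertex[OF i] by simp
    then have "T (v i) \<notin> side v j" if "j \<in> {1..6}" for j using side_eq[OF that] by simp
    ultimately show ?thesis unfolding hexagon_loop_def by blast
  qed
  then obtain p where p: "\<And>i. i \<in> {1..6} \<Longrightarrow> p i \<in> {1..6} \<and> T (v i) = v (p i)" by metis
  have chord: "on_chord (v i) (v (p i)) k" if "i \<in> {1..6}" for i
    using on_chord_reflection[OF k(1) norm_vertex[OF that]] p[OF that] k(2) by simp
  have pp: "p (p i) = i" if i: "i \<in> {1..6}" for i
  proof -
    have "v (p (p i)) = T (T (v i))" using p[OF i] p[of "p i"] by simp
    also have "\<dots> = v i" unfolding k(2) using reflection_involution[OF k(1)] norm_vertex[OF i] by simp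
    finally show ?thesis using vertex_distinct p i by metis
  qed
  have pne: "p i \<noteq> i" if i: "i \<in> {1..6}" for i
  proof
    assume "p i = i"
    then have "on_chord (v i) (v i) k" using chord[OF i] by simp
    then have "2 * v i = k + v i * v i * cnj k" by (simp add: on_chord_def)
    then have "norm (2 * v i) \<le> norm k + norm (v i * v i * cnj k)" by (metis norm_triangle_ineq)
    then show False using k(1) norm_vertex[OF i] by (simp add: norm_mult)
  qed
  have opposite: "p i = i + 3 \<or> i = p i + 3" if i: "i \<in> {1..6}" for i
  proof (rule crossing_involution_is_antipodal[OF _ _ i])
    show "p i \<in> {1..6} \<and> p i \<noteq> i \<and> p (p i) = i" if "i \<in> {1..6}" for i using p pp pne that by blast
    show "(j \<in> {min i (p i)<..<max i (p i)}) \<noteq> (p j \<in> {min i (p i)<..<max i (p i)})"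
      if h: "i \<in> {1..6}" "j \<in> {1..6}" "j \<noteq> i" "j \<noteq> p i" for i j
    proof -
      have p6: "p i \<in> {1..6}" "p j \<in> {1..6}" and ne: "i \<noteq> p i" "j \<noteq> p j"
        using p[OF h(1)] p[OF h(2)] pne[OF h(1)] pne[OF h(2)] by auto
      have "p j \<noteq> i" using pp[OF h(2)] h(4) by auto
      moreover have "p j \<noteq> p i" using pp[OF h(1)] pp[OF h(2)] h(3) by auto
      ultimately have out: "j \<notin> {i, p i}" "p j \<notin> {i, p i}" using h(3,4) by simp_all
      show ?thesis
        by (rule chords_cross[OF h(1) p6(1) ne(1) h(2) p6(2) ne(2) out k(1) chord[OF h(1)] chord[OF h(2)]])
    qed
  qed
  have "p 1 = 4" "p 2 = 5" "p 3 = 6"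
    using opposite[of 1] opposite[of 2] opposite[of 3] p[of 3] by simp_all
  then show ?thesis using chord[of 1] chord[of 2] chord[of 3] k(1) concurrent_iff by auto
qed

text \<open>
  The reflection in the common point exchanges opposite vertices, hence opposite sides.
\<close>

lemma concurrent_imp_symmetric:
  assumes "opposite_geodesics_concurrent v"
  shows "point_reflection_symmetry (hexagon_loop v)"
proof -
  let ?P = "hexagon_loop v"
  obtain k where k: "norm k < 1" and c: "on_chord (v 1) (v 4) k" "on_chord (v 2) (v 5) k" "on_chord (v 3) (v 6) k"
    using assms concurrent_iff by blast
  define T where "T = point_reflection k"
  define opp where "opp i = (if i \<le> 3 then i + 3 else i - 3)" for i :: nat
  have opp: "opp i \<in> {1..6}" "opp (next_index i) = next_index (opp i)" if "i \<in> {1..6}" for i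
    using that by (auto simp: opp_def next_index_def)
  have ni: "next_index i \<in> {1..6}" if "i \<in> {1..6}" for i using that by (auto simp: next_index_def)
  have c': "on_chord (v 4) (v 1) k" "on_chord (v 5) (v 2) k" "on_chord (v 6) (v 3) k"
    using c unfolding on_chord_def by (simp_all add: algebra_simps)
  have Tv: "T (v i) = v (opp i)" if i: "i \<in> {1..6}" for i
  proof -
    have "i = 1 \<or> i = 2 \<or> i = 3 \<or> i = 4 \<or> i = 5 \<or> i = 6" using i by auto
    then have "on_chord (v i) (v (opp i)) k" using c c' by (elim disjE) (simp_all add: opp_def)
    then show ?thesis using on_chord_reflection[OF k norm_vertex[OF i]] by (simp add: T_def)
  qed
  have Tside: "T z \<in> side v (opp i)" if i: "i \<in> {1..6}" and z: "z \<in> side v i" for i z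
  proof -
    have z': "z \<in> orthocircle (v i) (v (next_index i))" "norm z < 1" using z side_eq[OF i] by simp_all
    have "T z \<in> orthocircle (T (v i)) (T (v (next_index i)))" unfolding T_def
      using reflection_orthocircle[OF k norm_vertex[OF i] norm_vertex[OF ni[OF i]] z'] .
    moreover have "norm (T z) < 1" unfolding T_def using reflection_norm(2)[OF k] z'(2) by simp
    ultimately show ?thesis unfolding side_eq[OF opp(1)[OF i]] Tv[OF i] Tv[OF ni[OF i]] opp(2)[OF i] by simp
  qed
  have sub: "T z \<in> ?P" if "z \<in> ?P" for z
    using that Tside Tv opp(1) unfolding hexagon_loop_def by blast
  have Pn: "norm z \<le> 1" if "z \<in> ?P" for z
    using that norm_vertex side_eq unfolding hexagon_loop_def by fastforce
  have invol: "T (T z) = z" if "norm z \<le> 1" for z unfolding T_def using reflection_involution[OF k that] .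
  have "T ` ?P = ?P"
  proof
    show "T ` ?P \<subseteq> ?P" using sub by blast
    show "?P \<subseteq> T ` ?P"
    proof
      fix z assume "z \<in> ?P"
      then show "z \<in> T ` ?P" using sub invol Pn by (metis imageI)
    qed
  qed
  moreover have fixed: "\<exists>!z. z \<in> hyp_plane \<and> T z = z" unfolding T_def by (rule reflection_fixed[OF k])
  moreover have "\<exists>z\<in>hyp_plane. T z \<noteq> z"
  proof (rule ccontr)
    assume "\<not> ?thesis"
    then have "T 0 = 0" "T (1/2) = 1/2" by simp_all
    moreover have "(0::complex) \<in> hyp_plane" "(1/2::complex) \<in> hyp_plane" by simp_all
    ultimately have "(0::complex) = 1/2" using fixed by blast
    then show False by simp
  qed
  moreover have "hyp_isometry T" unfolding T_def by (rule reflection_hyp_isometry[OF k])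
  moreover have "\<forall>z\<in>hyp_plane. T (T z) = z" using invol by simp
  ultimately show ?thesis unfolding point_reflection_symmetry_def by blast
qed

end

theorem theorem3p2:
  fixes v :: "nat \<Rightarrow> complex"
  assumes "ideal_hexagon v"
  shows "(opposite_geodesics_concurrent v \<longleftrightarrow> point_reflection_symmetry (hexagon_loop v)) \<and>
         (point_reflection_symmetry (hexagon_loop v) \<longleftrightarrow> alternating_perimeter v = 0)"
proof -
  obtain \<theta> \<sigma> where "cyclic_hexagon v \<theta> \<sigma>"
    using assms unfolding ideal_hexagon_def cyclic_hexagon_def by blast
  then interpret cyclic_hexagon v \<theta> \<sigma> .
  show ?thesis
    using symmetric_imp_concurrent concurrent_imp_symmetric concurrent_iff_perimeter by blast
qed

end
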